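(* Let $n\ge 3$ and let $\mu_{\rm he}\in V_n$ be the Lie bracket defined by $\mu_{\rm he}(X_1,X_2)=X_3$ and zero on the remaining pairs of basis vectors, where $\{X_1,\dots,X_n\}$ is a fixed orthonormal basis of $\mathbb{C}^n$. The functional $F_n:L_n\to\mathbb{R}$ attains its maximum value at $[\mu]\in L_n$ if and only if $[\mu]\in\mathrm{GL}(n).[\mu_{\rm he}]$. Furthermore, $F_n([\mu_{\rm he}])=12$.
   Context: Let $V_n=\Lambda^2(\mathbb{C}^n)^*\otimes\mathbb{C}^n$ be the space of alternating bilinear maps $\mathbb{C}^n\times\mathbb{C}^n\to\mathbb{C}^n$, with $\mathrm{GL}(n)=\mathrm{GL}(n,\mathbb{C})$ acting by $g.\mu(X,Y)=g\mu(g^{-1}X,g^{-1}Y)$ and on $\mathbb{P}V_n$ by $g.[\mu]=[g.\mu]$. Fix the usual hermitian inner product $\langle\cdot,\cdot\rangle$ on $\mathbb{C}^n$; ${}^*$ is the adjoint with respect to it. On $V_n$ use $\langle\mu,\lambda\rangle=\sum_{i,j,k}\langle\mu(X_i,X_j),X_k\rangle\overline{\langle\lambda(X_i,X_j),X_k\rangle}$, $\{X_i\}$ any orthonormal basis of $\mathbb{C}^n$. For $\mu\in V_n$, let $\mathrm{ad}_\mu X(Y)=\mu(X,Y)$ and $$M_\mu=-4\sum_i(\mathrm{ad}_\mu X_i)^*\mathrm{ad}_\mu X_i+2\sum_i\mathrm{ad}_\mu X_i(\mathrm{ad}_\mu X_i)^*.$$ $\mathbb{P}V_n$ is the projective space of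 $V_n$, $[\mu]$ the class of $\mu\neq0$, and $F_n:\mathbb{P}V_n\to\mathbb{R}$ is $F_n([\mu])=\mathrm{tr}\,M_\mu^2$ for $\|\mu\|=1$. $L_n\subset\mathbb{P}V_n$ is the set of $[\mu]$ with $\mu\ne0$ satisfying the Jacobi identity. *)

theory Defs
  imports "HOL-Analysis.Analysis"
begin

type_synonym 'n bracket = "complex^'n \<Rightarrow> complex^'n \<Rightarrow> complex^'n"

text \<open>The library's inner product on \<^typ>\<open>complex^'n\<close> is only the real part of the hermitian one.\<close>

definition hinner :: "complex^'n \<Rightarrow> complex^'n \<Rightarrow> complex" where
  "hinner x y = (\<Sum>i\<in>UNIV. x $ i * cnj (y $ i))"

definition orthonormal_basis :: "(nat \<Rightarrow> complex^'n) \<Rightarrow> bool" where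
  "orthonormal_basis X \<longleftrightarrow>
     (\<forall>i\<in>{1..CARD('n)}. \<forall>j\<in>{1..CARD('n)}. hinner (X i) (X j) = (if i = j then 1 else 0))"

definition adj :: "complex^'n^'m \<Rightarrow> complex^'m^'n" where
  "adj A = (\<chi> i j. cnj (A $ j $ i))"

text \<open>The space of alternating complex-bilinear maps. Its vector space structure is the pointwise one.\<close>

definition Vn :: "'n::finite bracket set" where
  "Vn = {\<mu>. (\<forall>x. Vector_Spaces.linear (*s) (*s) (\<mu> x)) \<and>
             (\<forall>y. Vector_Spaces.linear (*s) (*s) (\<lambda>x. \<mu> x y)) \<and>
             (\<forall>x. \<mu> x x = 0)}"

definition smul :: "complex \<Rightarrow> ('n::finite) bracket \<Rightarrow> 'n bracket" where
  "smul c \<mu> = (\<lambda>x y. c *s \<mu> x y)"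

text \<open>The sums over an orthonormal basis in the next definition and in that of \<open>Mmat\<close> are taken
  over the standard basis; \<open>vinner_basis_indep\<close> and \<open>Mmat_basis_indep\<close> below show that any
  orthonormal basis gives the same value.\<close>

definition vinner :: "('n::finite) bracket \<Rightarrow> 'n bracket \<Rightarrow> complex" where
  "vinner \<mu> \<nu> = (\<Sum>i\<in>UNIV. \<Sum>j\<in>UNIV. \<Sum>k\<in>UNIV.
      hinner (\<mu> (axis i 1) (axis j 1)) (axis k 1) * cnj (hinner (\<nu> (axis i 1) (axis j 1)) (axis k 1)))"

definition vnorm :: "('n::finite) bracket \<Rightarrow> real" where
  "vnorm \<mu> = sqrt (Re (vinner \<mu> \<mu>))"

definition ad :: "('n::finite) bracket \<Rightarrow> complex^'n \<Rightarrow> complex^'n^'n" where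
  "ad \<mu> x = matrix (\<mu> x)"

definition Mmat :: "('n::finite) bracket \<Rightarrow> complex^'n^'n" where
  "Mmat \<mu> = (- 4) *\<^sub>R (\<Sum>i\<in>UNIV. adj (ad \<mu> (axis i 1)) ** ad \<mu> (axis i 1))
          + 2 *\<^sub>R (\<Sum>i\<in>UNIV. ad \<mu> (axis i 1) ** adj (ad \<mu> (axis i 1)))"

text \<open>A point of projective space is a line with the origin removed.\<close>

definition proj :: "('n::finite) bracket \<Rightarrow> 'n bracket set" where
  "proj \<mu> = {smul c \<mu> | c. c \<noteq> 0}"

definition act :: "complex^'n^'n \<Rightarrow> ('n::finite) bracket \<Rightarrow> 'n bracket" where
  "act g \<mu> = (\<lambda>x y. g *v \<mu> (matrix_inv g *v x) (matrix_inv g *v y))"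

definition pact :: "complex^'n^'n \<Rightarrow> ('n::finite) bracket set \<Rightarrow> 'n bracket set" where
  "pact g p = act g ` p"

definition GL_orbit :: "('n::finite) bracket set \<Rightarrow> 'n bracket set set" where
  "GL_orbit p = {pact g p | g. invertible g}"

definition jacobi :: "('n::finite) bracket \<Rightarrow> bool" where
  "jacobi \<mu> \<longleftrightarrow> (\<forall>x y z. \<mu> x (\<mu> y z) + \<mu> y (\<mu> z x) + \<mu> z (\<mu> x y) = 0)"

definition Lie_n :: "'n::finite bracket set set" where
  "Lie_n = {proj \<mu> | \<mu>. \<mu> \<in> Vn \<and> \<mu> \<noteq> (\<lambda>x y. 0) \<and> jacobi \<mu>}"

text \<open>That this is well defined on projective space is \<open>Fn_proj\<close> below.\<close>

definition Fn :: "('n::finite) bracket set \<Rightarrow> real" where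
  "Fn p = (THE r. \<exists>\<mu>\<in>p. vnorm \<mu> = 1 \<and> trace (Mmat \<mu> ** Mmat \<mu>) = complex_of_real r)"

lemma hinner_adj: "hinner (A *v x) y = hinner x (adj A *v y)"
proof -
  have "hinner (A *v x) y = (\<Sum>i\<in>UNIV. \<Sum>j\<in>UNIV. A $ i $ j * x $ j * cnj (y $ i))"
    by (simp add: hinner_def matrix_vector_mult_def sum_distrib_right)
  also have "\<dots> = (\<Sum>j\<in>UNIV. \<Sum>i\<in>UNIV. A $ i $ j * x $ j * cnj (y $ i))"
    by (rule sum.swap)
  also have "\<dots> = hinner x (adj A *v y)"
    by (simp add: hinner_def adj_def matrix_vector_mult_def sum_distrib_left mult_ac)
  finally show ?thesis .
qed

lemma hinner_axis: "hinner x (axis k 1) = x $ k"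
proof -
  have "hinner x (axis k 1) = (\<Sum>i\<in>UNIV. if i = k then x $ i else 0)"
    unfolding hinner_def by (rule sum.cong) (auto simp: axis_def)
  then show ?thesis by simp
qed

lemma vec_expand: "x = (\<Sum>a\<in>UNIV. (x $ a) *s axis a (1::complex))"
  by (simp add: basis_expansion)

lemma linear_coord:
  fixes f :: "complex^'n \<Rightarrow> complex^'m"
  assumes "Vector_Spaces.linear (*s) (*s) f"
  shows "f x $ k = (\<Sum>a\<in>UNIV. x $ a * f (axis a 1) $ k)"
proof -
  interpret Vector_Spaces.linear "(*s)" "(*s)" f by fact
  have "f x = f (\<Sum>a\<in>UNIV. (x $ a) *s axis a 1)" by (subst vec_expand) simp
  also have "\<dots> = (\<Sum>a\<in>UNIV. (x $ a) *s f (axis a 1))" by (simp add: sum scale)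
  finally show ?thesis by simp
qed

lemma onb_complete:
  fixes X :: "nat \<Rightarrow> complex^'n"
  assumes "orthonormal_basis X"
  shows "(\<Sum>k\<in>{1..CARD('n)}. cnj (X k $ a) * X k $ b) = (if a = b then 1 else 0)"
proof -
  obtain h :: "'n \<Rightarrow> nat" where h: "bij_betw h UNIV {1..CARD('n)}"
    by (metis card_atLeastAtMost diff_Suc_1 finite finite_atLeastAtMost finite_same_card_bij)
  define U :: "complex^'n^'n" where "U = (\<chi> i a. X (h i) $ a)"
  have hin: "h i \<in> {1..CARD('n)}" for i using h by (auto simp: bij_betw_def)
  have hinj: "h i = h j \<longleftrightarrow> i = j" for i j using h by (auto simp: bij_betw_def inj_on_def)
  have "(U ** adj U) $ i $ j = hinner (X (h i)) (X (h j))" for i j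
    by (simp add: U_def adj_def matrix_matrix_mult_def hinner_def)
  then have "U ** adj U = mat 1"
    using assms hin hinj by (simp add: vec_eq_iff mat_def orthonormal_basis_def)
  then have "adj U ** U = mat 1" by (simp add: matrix_left_right_inverse)
  then have "(adj U ** U) $ a $ b = (if a = b then 1 else 0)" by (simp add: mat_def)
  then have "(\<Sum>i\<in>UNIV. cnj (X (h i) $ a) * X (h i) $ b) = (if a = b then 1 else 0)"
    by (simp add: U_def adj_def matrix_matrix_mult_def)
  then show ?thesis
    by (simp add: sum.reindex_bij_betw[OF h, where g = "\<lambda>k. cnj (X k $ a) * X k $ b"])
qed

lemma onb_parseval:
  fixes X :: "nat \<Rightarrow> complex^'n"
  assumes "orthonormal_basis X"
  shows "(\<Sum>k\<in>{1..CARD('n)}. (\<Sum>a\<in>UNIV. X k $ a * f a) * cnj (\<Sum>b\<in>UNIV. X k $ b * g b))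
       = (\<Sum>a\<in>UNIV. f a * cnj (g a))" (is "?L = _")
proof -
  have "?L = (\<Sum>k\<in>{1..CARD('n)}. \<Sum>a\<in>UNIV. \<Sum>b\<in>UNIV. (cnj (X k $ b) * X k $ a) * (f a * cnj (g b)))"
    by (simp add: sum_product mult_ac)
  also have "\<dots> = (\<Sum>a\<in>UNIV. \<Sum>k\<in>{1..CARD('n)}. \<Sum>b\<in>UNIV. (cnj (X k $ b) * X k $ a) * (f a * cnj (g b)))"
    by (rule sum.swap)
  also have "\<dots> = (\<Sum>a\<in>UNIV. \<Sum>b\<in>UNIV. \<Sum>k\<in>{1..CARD('n)}. (cnj (X k $ b) * X k $ a) * (f a * cnj (g b)))"
    by (intro sum.cong refl sum.swap)
  also have "\<dots> = (\<Sum>a\<in>UNIV. \<Sum>b\<in>UNIV. (if b = a then 1 else 0) * (f a * cnj (g b)))"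
    by (simp only: sum_distrib_right[symmetric] onb_complete[OF assms])
  also have "\<dots> = (\<Sum>a\<in>UNIV. \<Sum>b\<in>UNIV. if b = a then f a * cnj (g b) else 0)"
    by (intro sum.cong refl) auto
  also have "\<dots> = (\<Sum>a\<in>UNIV. f a * cnj (g a))" by simp
  finally show ?thesis .
qed

lemma onb_parseval_hinner:
  fixes X :: "nat \<Rightarrow> complex^'n"
  assumes "orthonormal_basis X"
  shows "(\<Sum>k\<in>{1..CARD('n)}. hinner x (X k) * cnj (hinner y (X k))) = (\<Sum>a\<in>UNIV. x $ a * cnj (y $ a))"
proof -
  have "(\<Sum>k\<in>{1..CARD('n)}. hinner x (X k) * cnj (hinner y (X k)))
     = (\<Sum>k\<in>{1..CARD('n)}. (\<Sum>a\<in>UNIV. X k $ a * cnj (y $ a)) * cnj (\<Sum>a\<in>UNIV. X k $ a * cnj (x $ a)))"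
    by (intro sum.cong refl) (simp add: hinner_def mult_ac)
  also have "\<dots> = (\<Sum>a\<in>UNIV. x $ a * cnj (y $ a))"
    by (subst onb_parseval[OF assms]) (simp add: mult_ac)
  finally show ?thesis .
qed

lemma Vn_linear1: "\<mu> \<in> Vn \<Longrightarrow> \<mu> x y $ k = (\<Sum>a\<in>UNIV. x $ a * \<mu> (axis a 1) y $ k)"
  by (rule linear_coord[where f = "\<lambda>x. \<mu> x y"]) (simp add: Vn_def)

lemma Vn_linear2: "\<mu> \<in> Vn \<Longrightarrow> \<mu> x y $ k = (\<Sum>a\<in>UNIV. y $ a * \<mu> x (axis a 1) $ k)"
  by (rule linear_coord) (simp add: Vn_def)

lemma Vn_parseval1:
  fixes X :: "nat \<Rightarrow> complex^'n"
  assumes "orthonormal_basis X" "\<mu> \<in> Vn" "\<nu> \<in> Vn"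
  shows "(\<Sum>i\<in>{1..CARD('n)}. \<mu> (X i) y $ k * cnj (\<nu> (X i) z $ l))
       = (\<Sum>a\<in>UNIV. \<mu> (axis a 1) y $ k * cnj (\<nu> (axis a 1) z $ l))"
  using onb_parseval[OF assms(1), of "\<lambda>a. \<mu> (axis a 1) y $ k" "\<lambda>a. \<nu> (axis a 1) z $ l"]
  by (simp only: Vn_linear1[OF assms(2), symmetric] Vn_linear1[OF assms(3), symmetric])

lemma Vn_parseval2:
  fixes X :: "nat \<Rightarrow> complex^'n"
  assumes "orthonormal_basis X" "\<mu> \<in> Vn" "\<nu> \<in> Vn"
  shows "(\<Sum>i\<in>{1..CARD('n)}. \<mu> y (X i) $ k * cnj (\<nu> z (X i) $ l))
       = (\<Sum>a\<in>UNIV. \<mu> y (axis a 1) $ k * cnj (\<nu> z (axis a 1) $ l))"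
  using onb_parseval[OF assms(1), of "\<lambda>a. \<mu> y (axis a 1) $ k" "\<lambda>a. \<nu> z (axis a 1) $ l"]
  by (simp only: Vn_linear2[OF assms(2), symmetric] Vn_linear2[OF assms(3), symmetric])

lemma vinner_coord:
  "vinner \<mu> \<nu> = (\<Sum>i\<in>UNIV. \<Sum>j\<in>UNIV. \<Sum>k\<in>UNIV.
      \<mu> (axis i 1) (axis j 1) $ k * cnj (\<nu> (axis i 1) (axis j 1) $ k))"
  by (simp add: vinner_def hinner_axis)

lemma vinner_basis_indep:
  fixes X :: "nat \<Rightarrow> complex^'n"
  assumes "orthonormal_basis X" "\<mu> \<in> Vn" "\<nu> \<in> Vn"
  shows "vinner \<mu> \<nu> = (\<Sum>i\<in>{1..CARD('n)}. \<Sum>j\<in>{1..CARD('n)}. \<Sum>k\<in>{1..CARD('n)}.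
      hinner (\<mu> (X i) (X j)) (X k) * cnj (hinner (\<nu> (X i) (X j)) (X k)))" (is "_ = ?R")
proof -
  let ?N = "{1..CARD('n)}"
  have "?R = (\<Sum>i\<in>?N. \<Sum>j\<in>?N. \<Sum>k\<in>UNIV. \<mu> (X i) (X j) $ k * cnj (\<nu> (X i) (X j) $ k))"
    by (simp only: onb_parseval_hinner[OF assms(1)])
  also have "\<dots> = (\<Sum>i\<in>?N. \<Sum>k\<in>UNIV. \<Sum>j\<in>?N. \<mu> (X i) (X j) $ k * cnj (\<nu> (X i) (X j) $ k))"
    by (intro sum.cong refl sum.swap)
  also have "\<dots> = (\<Sum>i\<in>?N. \<Sum>k\<in>UNIV. \<Sum>j\<in>UNIV. \<mu> (X i) (axis j 1) $ k * cnj (\<nu> (X i) (axis j 1) $ k))"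
    by (simp only: Vn_parseval2[OF assms])
  also have "\<dots> = (\<Sum>k\<in>UNIV. \<Sum>i\<in>?N. \<Sum>j\<in>UNIV. \<mu> (X i) (axis j 1) $ k * cnj (\<nu> (X i) (axis j 1) $ k))"
    by (rule sum.swap)
  also have "\<dots> = (\<Sum>k\<in>UNIV. \<Sum>j\<in>UNIV. \<Sum>i\<in>?N. \<mu> (X i) (axis j 1) $ k * cnj (\<nu> (X i) (axis j 1) $ k))"
    by (intro sum.cong refl sum.swap)
  also have "\<dots> = (\<Sum>k\<in>UNIV. \<Sum>j\<in>UNIV. \<Sum>i\<in>UNIV. \<mu> (axis i 1) (axis j 1) $ k * cnj (\<nu> (axis i 1) (axis j 1) $ k))"
    by (simp only: Vn_parseval1[OF assms])
  also have "\<dots> = (\<Sum>j\<in>UNIV. \<Sum>k\<in>UNIV. \<Sum>i\<in>UNIV. \<mu> (axis i 1) (axis j 1) $ k * cnj (\<nu> (axis i 1) (axis j 1) $ k))"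
    by (rule sum.swap)
  also have "\<dots> = (\<Sum>j\<in>UNIV. \<Sum>i\<in>UNIV. \<Sum>k\<in>UNIV. \<mu> (axis i 1) (axis j 1) $ k * cnj (\<nu> (axis i 1) (axis j 1) $ k))"
    by (intro sum.cong refl sum.swap)
  also have "\<dots> = (\<Sum>i\<in>UNIV. \<Sum>j\<in>UNIV. \<Sum>k\<in>UNIV. \<mu> (axis i 1) (axis j 1) $ k * cnj (\<nu> (axis i 1) (axis j 1) $ k))"
    by (rule sum.swap)
  also have "\<dots> = vinner \<mu> \<nu>" by (simp only: vinner_coord)
  finally show ?thesis by simp
qed

lemma ad_nth: "ad \<mu> x $ i $ j = \<mu> x (axis j 1) $ i"
  by (simp add: ad_def matrix_def)

lemma adj_ad_mult_nth: "(adj (ad \<mu> x) ** ad \<mu> x) $ i $ j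
    = (\<Sum>l\<in>UNIV. \<mu> x (axis j 1) $ l * cnj (\<mu> x (axis i 1) $ l))"
  by (simp add: matrix_matrix_mult_def adj_def ad_nth mult.commute)

lemma ad_adj_mult_nth: "(ad \<mu> x ** adj (ad \<mu> x)) $ i $ j
    = (\<Sum>l\<in>UNIV. \<mu> x (axis l 1) $ i * cnj (\<mu> x (axis l 1) $ j))"
  by (simp add: matrix_matrix_mult_def adj_def ad_nth)

lemma Mmat_basis_indep:
  fixes X :: "nat \<Rightarrow> complex^'n"
  assumes "orthonormal_basis X" "\<mu> \<in> Vn"
  shows "Mmat \<mu> = (- 4) *\<^sub>R (\<Sum>i\<in>{1..CARD('n)}. adj (ad \<mu> (X i)) ** ad \<mu> (X i))
          + 2 *\<^sub>R (\<Sum>i\<in>{1..CARD('n)}. ad \<mu> (X i) ** adj (ad \<mu> (X i)))"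
proof -
  let ?N = "{1..CARD('n)}"
  have "(\<Sum>r\<in>?N. adj (ad \<mu> (X r)) ** ad \<mu> (X r)) $ i $ j
      = (\<Sum>r\<in>UNIV. adj (ad \<mu> (axis r 1)) ** ad \<mu> (axis r 1)) $ i $ j" for i j
    unfolding sum_component adj_ad_mult_nth
    by (subst (1 2) sum.swap) (simp only: Vn_parseval1[OF assms assms(2)])
  moreover have "(\<Sum>r\<in>?N. ad \<mu> (X r) ** adj (ad \<mu> (X r))) $ i $ j
      = (\<Sum>r\<in>UNIV. ad \<mu> (axis r 1) ** adj (ad \<mu> (axis r 1))) $ i $ j" for i j
    unfolding sum_component ad_adj_mult_nth
    by (subst (1 2) sum.swap) (simp only: Vn_parseval1[OF assms assms(2)])
  ultimately show ?thesis unfolding Mmat_def by (simp add: vec_eq_iff)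
qed

lemma vinner_self: "vinner \<mu> \<mu> = complex_of_real (\<Sum>i\<in>UNIV. \<Sum>j\<in>UNIV. \<Sum>k\<in>UNIV.
      (cmod (\<mu> (axis i 1) (axis j 1) $ k))\<^sup>2)"
  by (simp add: vinner_coord complex_norm_square del: of_real_power)

lemma vnorm_smul: "vnorm (smul c \<mu>) = cmod c * vnorm \<mu>"
proof -
  have "vinner (smul c \<mu>) (smul c \<mu>) = (c * cnj c) * vinner \<mu> \<mu>"
    by (simp add: vinner_coord smul_def sum_distrib_left mult_ac)
  also have "\<dots> = complex_of_real ((cmod c)\<^sup>2) * vinner \<mu> \<mu>"
    by (simp add: complex_norm_square del: of_real_power)
  finally have "Re (vinner (smul c \<mu>) (smul c \<mu>)) = (cmod c)\<^sup>2 * Re (vinner \<mu> \<mu>)"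
    by (simp only: Re_complex_of_real Im_complex_of_real times_complex.simps)
  then show ?thesis by (simp add: vnorm_def real_sqrt_mult)
qed

lemma Mmat_smul: "Mmat (smul c \<mu>) = (cmod c)\<^sup>2 *\<^sub>R Mmat \<mu>"
proof -
  have c: "c * x * cnj (c * y) = complex_of_real ((cmod c)\<^sup>2) * (x * cnj y)" for x y
    by (simp only: complex_norm_square complex_cnj_mult mult_ac)
  have "(adj (ad (smul c \<mu>) x) ** ad (smul c \<mu>) x) = (cmod c)\<^sup>2 *\<^sub>R (adj (ad \<mu> x) ** ad \<mu> x)" for x
    unfolding vec_eq_iff vector_scaleR_component adj_ad_mult_nth
    by (simp only: smul_def vector_smult_component c scaleR_conv_of_real sum_distrib_left) simp
  moreover have "(ad (smul c \<mu>) x ** adj (ad (smul c \<mu>) x)) = (cmod c)\<^sup>2 *\<^sub>R (ad \<mu> x ** adj (ad \<mu> x))" for x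
    unfolding vec_eq_iff vector_scaleR_component ad_adj_mult_nth
    by (simp only: smul_def vector_smult_component c scaleR_conv_of_real sum_distrib_left) simp
  ultimately show ?thesis
    by (simp add: Mmat_def scaleR_sum_right[symmetric] algebra_simps)
qed

lemma Mmat_adj: "cnj (Mmat \<mu> $ i $ j) = Mmat \<mu> $ j $ i"
  unfolding Mmat_def vector_add_component vector_scaleR_component sum_component
    adj_ad_mult_nth ad_adj_mult_nth
  by (simp add: mult.commute)

lemma trace_Mmat_real: "complex_of_real (Re (trace (Mmat \<mu> ** Mmat \<mu>))) = trace (Mmat \<mu> ** Mmat \<mu>)"
proof -
  have "cnj (trace (Mmat \<mu> ** Mmat \<mu>)) = (\<Sum>i\<in>UNIV. \<Sum>j\<in>UNIV. Mmat \<mu> $ j $ i * Mmat \<mu> $ i $ j)"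
    by (simp add: trace_def matrix_matrix_mult_def Mmat_adj)
  also have "\<dots> = trace (Mmat \<mu> ** Mmat \<mu>)"
    by (simp add: trace_def matrix_matrix_mult_def mult.commute)
  finally show ?thesis by (simp add: complex_eq_iff)
qed

lemma Fn_proj:
  assumes "vnorm \<mu> = 1"
  shows "complex_of_real (Fn (proj \<mu>)) = trace (Mmat \<mu> ** Mmat \<mu>)"
proof -
  have "\<exists>\<nu>\<in>proj \<mu>. vnorm \<nu> = 1 \<and> trace (Mmat \<nu> ** Mmat \<nu>)
      = complex_of_real (Re (trace (Mmat \<mu> ** Mmat \<mu>)))"
  proof
    show "\<mu> \<in> proj \<mu>"
      unfolding proj_def by (intro CollectI exI[of _ 1]) (simp add: smul_def)
  qed (simp add: assms trace_Mmat_real)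
  moreover have "r = Re (trace (Mmat \<mu> ** Mmat \<mu>))"
    if "\<exists>\<nu>\<in>proj \<mu>. vnorm \<nu> = 1 \<and> trace (Mmat \<nu> ** Mmat \<nu>) = complex_of_real r" for r
  proof -
    from that obtain c where "vnorm (smul c \<mu>) = 1"
      and r: "trace (Mmat (smul c \<mu>) ** Mmat (smul c \<mu>)) = complex_of_real r"
      by (auto simp: proj_def)
    then have "Mmat (smul c \<mu>) = Mmat \<mu>" by (simp add: vnorm_smul assms Mmat_smul)
    with r show ?thesis by simp
  qed
  ultimately have "Fn (proj \<mu>) = Re (trace (Mmat \<mu> ** Mmat \<mu>))"
    unfolding Fn_def by (rule the_equality)
  then show ?thesis by (simp add: trace_Mmat_real)
qed

lemma pact_proj: "pact g (proj \<mu>) = proj (act g \<mu>)"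
proof -
  have "act g (smul c \<mu>) = smul c (act g \<mu>)" for c
    by (simp add: act_def smul_def matrix_vector_mult_def fun_eq_iff vec_eq_iff sum_distrib_left mult_ac)
  then show ?thesis by (auto simp: pact_def proj_def image_iff) metis
qed

lemma Vn_normalize:
  assumes "\<mu> \<in> Vn" "\<mu> \<noteq> (\<lambda>x y. 0)"
  shows "\<exists>\<nu>\<in>proj \<mu>. vnorm \<nu> = 1"
proof -
  have "vnorm \<mu> \<noteq> 0"
  proof
    assume "vnorm \<mu> = 0"
    then have "(\<Sum>i\<in>UNIV. \<Sum>j\<in>UNIV. \<Sum>k\<in>UNIV. (cmod (\<mu> (axis i 1) (axis j 1) $ k))\<^sup>2) = 0"
      unfolding vnorm_def vinner_self Re_complex_of_real real_sqrt_eq_zero_cancel_iff .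
    then have "\<mu> (axis i 1) (axis j 1) $ k = 0" for i j k
      by (simp add: sum_nonneg_eq_0_iff sum_nonneg)
    then have "\<mu> x y $ k = 0" for x y k
      by (subst Vn_linear1[OF assms(1)], subst Vn_linear2[OF assms(1)]) simp
    then have "\<mu> = (\<lambda>x y. 0)" by (simp add: fun_eq_iff vec_eq_iff)
    with assms(2) show False by simp
  qed
  moreover have "0 \<le> vnorm \<mu>" by (simp add: vnorm_def vinner_self sum_nonneg del: of_real_sum)
  ultimately have "vnorm (smul (complex_of_real (1 / vnorm \<mu>)) \<mu>) = 1"
    by (simp add: vnorm_smul norm_divide)
  with \<open>vnorm \<mu> \<noteq> 0\<close> show ?thesis
    unfolding proj_def by (intro bexI CollectI exI conjI) auto
qed

text \<open>The bracket that the hypotheses of the theorem describe exists, with its expected formula.\<close>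

lemma heisenberg_bracket_exists:
  fixes X :: "nat \<Rightarrow> complex^'n"
  assumes "CARD('n) \<ge> 3" "orthonormal_basis X"
  shows "\<exists>\<mu>\<in>Vn. \<mu> (X 1) (X 2) = X 3 \<and>
    (\<forall>i\<in>{1..CARD('n)}. \<forall>j\<in>{1..CARD('n)}. i < j \<and> (i, j) \<noteq> (1, 2) \<longrightarrow> \<mu> (X i) (X j) = 0)"
proof
  let ?\<mu> = "\<lambda>x y. (hinner x (X 1) * hinner y (X 2) - hinner x (X 2) * hinner y (X 1)) *s X 3"
  have add: "hinner (x + y) z = hinner x z + hinner y z" for x y z :: "complex^'n"
    by (simp add: hinner_def sum.distrib algebra_simps)
  have scale: "hinner (c *s x) z = c * hinner x z" for c and x z :: "complex^'n"
    by (simp add: hinner_def sum_distrib_left mult_ac)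
  have lin: "Vector_Spaces.linear (*s) (*s) f"
    if "\<And>x y. f (x + y) = f x + f y" "\<And>c x. f (c *s x) = c *s f x"
    for f :: "complex^'n \<Rightarrow> complex^'n"
    by (intro Vector_Spaces.linear.intro module_hom.intro module_hom_axioms.intro that
        vec.vector_space_axioms vec.module_axioms)
  show "?\<mu> \<in> Vn"
    unfolding Vn_def
    by (auto intro!: lin simp: add scale vec_eq_iff algebra_simps)
  have o: "hinner (X i) (X j) = (if i = j then 1 else 0)"
    if "i \<in> {1..CARD('n)}" "j \<in> {1..CARD('n)}" for i j
    using assms(2) that by (auto simp: orthonormal_basis_def)
  show "?\<mu> (X 1) (X 2) = X 3 \<and> (\<forall>i\<in>{1..CARD('n)}. \<forall>j\<in>{1..CARD('n)}.
      i < j \<and> (i, j) \<noteq> (1, 2) \<longrightarrow> ?\<mu> (X i) (X j) = 0)"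
    using assms(1) by (auto simp: o)
qed

end

theory Submission
  imports Defs
begin

text \<open>
  Diagonalise the hermitian matrix \<open>M\<^sub>\<mu>\<close> in an orthonormal basis and let \<open>p i j k\<close> be the squared
  modulus of the structure constants of \<open>\<mu>\<close> there, a probability distribution when \<open>\<mu>\<close> has norm 1.
  The vector \<open>m\<close> of eigenvalues is the \<open>p\<close>-average of the vectors \<open>2 (e\<^sub>k - e\<^sub>i - e\<^sub>j)\<close> (twice the
  weights of the representation), whose squared lengths are 12 when \<open>i, j, k\<close> are distinct and 4
  otherwise.  Hence \<open>tr M\<^sub>\<mu>\<^sup>2\<close>, the squared length of \<open>m\<close>, is at most 12 on all of \<open>V\<^sub>n\<close>, and equality
  forces \<open>p\<close> to live on a single weight with \<open>i, j, k\<close> distinct, so that \<open>\<mu>\<close> is a multiple of a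
  unitary translate of the Heisenberg bracket.  Conversely, Gram--Schmidt shows that every element of
  the \<open>GL(n)\<close>-orbit of the Heisenberg line is already a unitary translate of it.
\<close>

subsection \<open>Diagonalisation of hermitian matrices\<close>

lemma hinner_add_left: "hinner (x + y) z = hinner x z + hinner y z"
  by (simp add: hinner_def sum.distrib algebra_simps)

lemma hinner_diff_left: "hinner (x - y) z = hinner x z - hinner y z"
  by (simp add: hinner_def sum_subtractf algebra_simps)

lemma hinner_scale_left: "hinner (c *s x) z = c * hinner x z"
  by (simp add: hinner_def sum_distrib_left mult_ac)

lemma cnj_hinner: "cnj (hinner x y) = hinner y x"
  by (simp add: hinner_def mult.commute)

lemma hinner_add_right: "hinner z (x + y) = hinner z x + hinner z y"
  by (simp add: hinner_def sum.distrib algebra_simps)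

lemma hinner_diff_right: "hinner z (x - y) = hinner z x - hinner z y"
  by (simp add: hinner_def sum_subtractf algebra_simps)

lemma hinner_scale_right: "hinner z (c *s x) = cnj c * hinner z x"
  by (simp add: hinner_def sum_distrib_left mult_ac)

lemma hinner_zero_left: "hinner 0 x = 0"
  by (simp add: hinner_def)

lemma hinner_zero_right: "hinner x 0 = 0"
  by (simp add: hinner_def)

lemmas hinner_simps = hinner_add_left hinner_diff_left hinner_scale_left
  hinner_add_right hinner_diff_right hinner_scale_right hinner_zero_left hinner_zero_right

lemma hinner_self: "hinner x x = complex_of_real ((norm x)\<^sup>2)"
  by (simp add: hinner_def norm_vec_def L2_set_def complex_norm_square sum_nonneg
      del: of_real_power)

lemma hinner_self_eq_0_iff: "hinner x x = 0 \<longleftrightarrow> x = 0"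
  by (simp add: hinner_self del: of_real_power)

lemma continuous_on_hinner [continuous_intros]:
  assumes "continuous_on S f" "continuous_on S g"
  shows "continuous_on S (\<lambda>x. hinner (f x) (g x))"
  unfolding hinner_def by (intro continuous_intros assms)

lemma adj_adj [simp]: "adj (adj A) = A"
  by (simp add: adj_def vec_eq_iff)

text \<open>If \<open>L v \<noteq> 0\<close>, a small step from \<open>v\<close> in the direction \<open>- L v\<close> makes the form negative.\<close>

lemma psd_form_zero:
  fixes L :: "complex^'n^'n"
  assumes herm: "adj L = L"
    and psd: "\<And>x. x \<in> S \<Longrightarrow> Re (hinner (L *v x) x) \<ge> 0"
    and S: "vec.subspace S" "v \<in> S" "L *v v \<in> S"
    and 0: "Re (hinner (L *v v) v) = 0"
  shows "L *v v = 0"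
proof (rule ccontr)
  let ?w = "L *v v"
  define W where "W = (norm ?w)\<^sup>2"
  define Q where "Q = Re (hinner (L *v ?w) ?w)"
  assume "?w \<noteq> 0"
  then have W: "W > 0" by (simp add: W_def)
  have Q: "Q \<ge> 0" unfolding Q_def by (intro psd S)
  \<comment> \<open>Along \<open>v - s *s ?w\<close> the form equals
    \<open>- 2 * s * W + s * s * Q\<close>, which is negative once \<open>s * Q < 2 * W\<close>. The
    \<open>+ 1\<close> covers \<open>Q = 0\<close>.\<close>
  define s where "s = W / (Q + 1)"
  have s: "s > 0" using W Q by (simp add: s_def)
  let ?x = "v - complex_of_real s *s ?w"
  have "?x \<in> S" using S by (simp add: vec.subspace_diff vec.subspace_scale)
  then have "0 \<le> Re (hinner (L *v ?x) ?x)" by (rule psd)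
  also have "hinner (L *v ?x) ?x = hinner ?w v - s * hinner (L *v ?w) v
      - s * hinner ?w ?w + s * s * hinner (L *v ?w) ?w"
    by (simp add: matrix_vector_mult_diff_distrib vec.scale hinner_simps algebra_simps)
  also have "hinner (L *v ?w) v = hinner ?w ?w" by (simp add: hinner_adj herm)
  also have "Re (hinner ?w v - s * hinner ?w ?w - s * hinner ?w ?w + s * s * hinner (L *v ?w) ?w)
      = - (2 * s * W) + s * s * Q"
    using 0 by (simp add: hinner_self W_def Q_def del: of_real_power)
  finally have "2 * s * W \<le> s * s * Q" by simp
  then have "2 * W \<le> s * Q" using s by (simp add: mult.assoc)
  then have "2 * W * (Q + 1) \<le> W * Q" using Q by (simp add: s_def field_simps)
  moreover have "0 \<le> W * Q" "2 * W * (Q + 1) = 2 * (W * Q) + 2 * W"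
    using W Q by (simp_all add: algebra_simps)
  ultimately show False using W by linarith
qed

text \<open>The quadratic form of \<open>M\<close> attains a maximum \<open>r\<close> on the unit
  sphere of \<open>S\<close>. Then the form of \<open>r - M\<close> is nonnegative on
  \<open>S\<close> and vanishes at the maximiser, which \<open>psd_form_zero\<close> therefore
  places in the kernel of \<open>r - M\<close>. Invariance of \<open>S\<close> keeps the image of
  the maximiser inside \<open>S\<close>.\<close>

lemma hermitian_eigenvector_in_subspace:
  fixes M :: "complex^'n^'n"
  assumes herm: "adj M = M"
    and S: "vec.subspace S" "closed S" "\<And>x. x \<in> S \<Longrightarrow> M *v x \<in> S"
    and v0: "v0 \<in> S" "v0 \<noteq> 0"
  obtains v r where "v \<in> S" "norm v = 1" "M *v v = complex_of_real r *s v"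
proof -
  define f where "f x = Re (hinner (M *v x) x)" for x
  let ?K = "S \<inter> sphere 0 1"
  have sc: "complex_of_real c *s x = c *\<^sub>R x" for c and x :: "complex^'n"
    unfolding vec_eq_iff vector_scaleR_component vector_smult_component
    by (simp add: scaleR_conv_of_real)
  have scS: "c *\<^sub>R x \<in> S" if "x \<in> S" for c x
    using vec.subspace_scale[OF S(1) that, of "complex_of_real c"] by (simp add: sc)
  have "compact ?K" using S(2) by (simp add: closed_Int_compact)
  moreover have "(1 / norm v0) *\<^sub>R v0 \<in> ?K" using v0 by (auto intro: scS)
  then have "?K \<noteq> {}" by blast
  moreover have "continuous_on ?K f"
    unfolding f_def matrix_vector_mult_def by (intro continuous_intros)
  ultimately obtain v where v: "v \<in> ?K" and max: "\<And>x. x \<in> ?K \<Longrightarrow> f x \<le> f v"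
    using continuous_attains_sup by metis
  define L where "L = (\<chi> i j. (if i = j then complex_of_real (f v) else 0) - M $ i $ j)"
  have Lx: "L *v x = complex_of_real (f v) *s x - M *v x" for x
    by (simp add: L_def matrix_vector_mult_def vec_eq_iff left_diff_distrib sum_subtractf if_distrib[of "\<lambda>a. a * _"] cong: if_cong)
  have "L *v v = 0"
  proof (rule psd_form_zero[OF _ _ S(1)])
    show "adj L = L"
      using herm by (auto simp: L_def adj_def vec_eq_iff)
    show "v \<in> S" using v by simp
    show "L *v v \<in> S"
      unfolding Lx using v S by (intro vec.subspace_diff vec.subspace_scale) auto
    show "Re (hinner (L *v v) v) = 0"
      using v by (simp add: Lx hinner_simps hinner_self f_def)
    show "Re (hinner (L *v x) x) \<ge> 0" if x: "x \<in> S" for x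
    proof (cases "x = 0")
      case True
      then show ?thesis by (simp add: hinner_simps)
    next
      case False
      \<comment> \<open>The maximum controls only unit vectors; \<open>f\<close> is homogeneous of
        degree 2, so rescaling reaches all of \<open>S\<close>.\<close>
      let ?y = "complex_of_real (1 / norm x) *s x"
      have "?y \<in> ?K" using x False by (auto simp: sc intro: scS simp del: of_real_divide)
      then have "f ?y \<le> f v" by (rule max)
      also have "f ?y = f x / (norm x)\<^sup>2"
        by (simp add: f_def vec.scale hinner_simps power2_eq_square Re_divide_of_real flip: of_real_mult)
      finally show ?thesis
        using False by (simp add: Lx hinner_simps hinner_self f_def field_simps del: of_real_power)
    qed
  qed
  then have "M *v v = complex_of_real (f v) *s v" by (simp add: Lx)
  then show thesis using v that by auto
qed

text \<open>The conditions are \<open>k\<close> linear equations in more than \<open>k\<close>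
  unknowns. Padding them with zero rows gives a square matrix with determinant 0, hence with a
  nontrivial kernel; \<open>h\<close> merely numbers its rows.\<close>

lemma exists_orthogonal_vector:
  fixes X :: "nat \<Rightarrow> complex^'n"
  assumes "k < CARD('n)"
  obtains v where "v \<noteq> 0" "\<And>i. i \<in> {1..k} \<Longrightarrow> hinner v (X i) = 0"
proof -
  obtain h :: "'n \<Rightarrow> nat" where h: "bij_betw h UNIV {1..CARD('n)}"
    by (metis card_atLeastAtMost diff_Suc_1 finite finite_atLeastAtMost finite_same_card_bij)
  define A :: "complex^'n^'n" where "A = (\<chi> a b. if h a \<le> k then cnj (X (h a) $ b) else 0)"
  have surj: "\<exists>a. h a = i" if "i \<in> {1..CARD('n)}" for i
    using h that by (metis bij_betw_imp_surj_on imageE)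
  obtain a where "h a = CARD('n)" using surj[of "CARD('n)"] by fastforce
  then have "A $ a = 0" using assms by (simp add: A_def vec_eq_iff)
  then have "det A = 0" by (intro det_zero_row) (simp add: row_def vec_eq_iff)
  then have "\<not> invertible A" by (simp add: invertible_det_nz)
  then obtain v where v: "A *v v = 0" "v \<noteq> 0"
    by (metis invertible_left_inverse matrix_left_invertible_ker)
  have "hinner v (X i) = 0" if i: "i \<in> {1..k}" for i
  proof -
    obtain b where b: "h b = i" using surj[of i] i assms by auto
    have "(A *v v) $ b = hinner v (X i)"
      using b i by (simp add: A_def matrix_vector_mult_def hinner_def mult.commute)
    with v show ?thesis by simp
  qed
  with v(2) that show thesis by blast
qed

text \<open>Since \<open>M\<close> is hermitian, the orthogonal complement of the eigenvectors
  already found is invariant under \<open>M\<close>. It is nonzero while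
  \<open>k < CARD('n)\<close>, so it contains a further unit eigenvector.\<close>

lemma hermitian_partial_eigenbasis:
  fixes M :: "complex^'n^'n"
  assumes herm: "adj M = M" and "k \<le> CARD('n)"
  shows "\<exists>X m. (\<forall>i\<in>{1..k}. \<forall>j\<in>{1..k}. hinner (X i) (X j) = (if i = j then 1 else 0))
    \<and> (\<forall>i\<in>{1..k}. M *v X i = complex_of_real (m i) *s X i)"
  using assms(2)
proof (induction k)
  case 0
  then show ?case by simp
next
  case (Suc k)
  then have "\<exists>X m. (\<forall>i\<in>{1..k}. \<forall>j\<in>{1..k}. hinner (X i) (X j) = (if i = j then 1 else 0))
      \<and> (\<forall>i\<in>{1..k}. M *v X i = complex_of_real (m i) *s X i)"
    using Suc_leD by blast
  then obtain X m where o: "\<forall>i\<in>{1..k}. \<forall>j\<in>{1..k}. hinner (X i) (X j) = (if i = j then 1 else 0)"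
    and e: "\<forall>i\<in>{1..k}. M *v X i = complex_of_real (m i) *s X i"
    by blast
  define S where "S = {x. \<forall>i\<in>{1..k}. hinner x (X i) = 0}"
  have "k < CARD('n)" using Suc.prems by simp
  then obtain v0 where "v0 \<noteq> 0" "\<And>i. i \<in> {1..k} \<Longrightarrow> hinner v0 (X i) = 0"
    using exists_orthogonal_vector by metis
  then have v0: "v0 \<in> S" "v0 \<noteq> 0" by (simp_all add: S_def)
  have "vec.subspace S" by (auto simp: S_def vec.subspace_def hinner_simps)
  moreover have "closed S"
  proof -
    have "S = (\<Inter>i\<in>{1..k}. {x. hinner x (X i) = 0})" by (auto simp: S_def)
    also have "closed \<dots>" by (intro closed_INT ballI closed_Collect_eq continuous_intros)
    finally show ?thesis .
  qed
  moreover have "M *v x \<in> S" if "x \<in> S" for x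
    using that by (simp add: S_def hinner_adj herm e hinner_simps)
  ultimately obtain v r where v: "v \<in> S" "norm v = 1" "M *v v = complex_of_real r *s v"
    using hermitian_eigenvector_in_subspace[OF herm _ _ _ v0] by blast
  have "hinner v (X i) = 0" "hinner (X i) v = 0" if "i \<in> {1..k}" for i
    using v(1) that cnj_hinner[of v "X i"] by (auto simp: S_def)
  moreover have "hinner v v = 1" using v(2) by (simp add: hinner_self)
  ultimately show ?case
    using o e v(3)
    by (intro exI[of _ "X(Suc k := v)"] exI[of _ "m(Suc k := r)"]) (auto simp: atLeastAtMostSuc_conv)
qed

lemma hermitian_eigenbasis:
  fixes M :: "complex^'n^'n"
  assumes "adj M = M"
  obtains X m where "orthonormal_basis X"
    "\<And>i. i \<in> {1..CARD('n)} \<Longrightarrow> M *v X i = complex_of_real (m i) *s X i"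
  using hermitian_partial_eigenbasis[OF assms order_refl] unfolding orthonormal_basis_def by metis

subsection \<open>The moment inequality on weights\<close>

text \<open>The vector \<open>e_k - e_i - e_j\<close>: the weight with which diagonal matrices act
  on the structure constant with inputs \<open>i\<close>, \<open>j\<close> and output
  \<open>k\<close>. Coinciding indices add up or cancel.\<close>

definition weight :: "'a \<Rightarrow> 'a \<Rightarrow> 'a \<Rightarrow> 'a \<Rightarrow> real" where
  "weight i j k a = of_bool (a = k) - of_bool (a = i) - of_bool (a = j)"

text \<open>If \<open>k\<close> meets \<open>i\<close> or \<open>j\<close>, two unit vectors cancel
  and one remains; otherwise there are three separate entries of modulus 1. For \<open>i = j\<close>
  different from \<open>k\<close> the value would be 5, whence the assumption
  \<open>i \<noteq> j\<close>.\<close>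

lemma sum_weight_sq:
  assumes "finite N" "i \<in> N" "j \<in> N" "k \<in> N" "i \<noteq> j"
  shows "(\<Sum>a\<in>N. (weight i j k a)\<^sup>2) = (if k = i \<or> k = j then 1 else 3)"
proof -
  have "(\<Sum>a\<in>N. (weight i j k a)\<^sup>2) = (\<Sum>a\<in>{i,j,k}. (weight i j k a)\<^sup>2)"
    using assms by (intro sum.mono_neutral_right) (auto simp: weight_def)
  also have "\<dots> = (if k = i \<or> k = j then 1 else 3)"
    using assms(5) by (auto simp: weight_def insert_commute)
  finally show ?thesis .
qed

text \<open>For distinct indices the entry 1 occurs only at \<open>k\<close> and the entry -1 only
  at \<open>i\<close> and \<open>j\<close>, so the vector determines \<open>k\<close> and the
  unordered pair of inputs.\<close>

lemma weight_eqD: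
  assumes "finite N" "{i, j, k, i', j', k'} \<subseteq> N" "i' \<noteq> j'" "k' \<noteq> i'" "k' \<noteq> j'"
    "i \<noteq> j" "k \<noteq> i" "k \<noteq> j"
    and eq: "\<And>a. a \<in> N \<Longrightarrow> weight i j k a = weight i' j' k' a"
  shows "k' = k \<and> (i' = i \<and> j' = j \<or> i' = j \<and> j' = i)"
proof -
  have "weight i j k k' = 1" "weight i j k i' = - 1" "weight i j k j' = - 1"
    using assms(2-5) eq[of k'] eq[of i'] eq[of j'] by (auto simp: weight_def)
  then have "k' = k" "i' \<in> {i, j}" "j' \<in> {i, j}"
    by (auto simp: weight_def of_bool_def split: if_splits)
  then show ?thesis using assms(3) by auto
qed

text \<open>Squared length of the mean plus variance equals mean squared length. Thus 12 minus the
  squared length of \<open>m\<close> is a \<open>p\<close>-average of nonnegative terms: the squared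
  distance from \<open>m\<close> to \<open>2 * weight\<close>, and the amount by which the squared
  length of \<open>2 * weight\<close> falls short of 12. In the equality case both vanish wherever
  \<open>p\<close> does not.\<close>

lemma weighted_moment_bound:
  fixes p :: "'a \<Rightarrow> 'a \<Rightarrow> 'a \<Rightarrow> real"
  assumes fin: "finite N" and nn: "\<And>i j k. p i j k \<ge> 0"
    and sym: "\<And>i j k. p i j k = p j i k" and diag: "\<And>i k. p i i k = 0"
    and total: "(\<Sum>i\<in>N. \<Sum>j\<in>N. \<Sum>k\<in>N. p i j k) = 1"
    and m: "\<And>a. a \<in> N \<Longrightarrow> m a = - 4 * (\<Sum>i\<in>N. \<Sum>k\<in>N. p i a k) + 2 * (\<Sum>i\<in>N. \<Sum>j\<in>N. p i j a)"
  shows "(\<Sum>a\<in>N. (m a)\<^sup>2) \<le> 12"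
    and "\<lbrakk>(\<Sum>a\<in>N. (m a)\<^sup>2) = 12; i \<in> N; j \<in> N; k \<in> N; p i j k \<noteq> 0\<rbrakk> \<Longrightarrow>
      i \<noteq> j \<and> k \<noteq> i \<and> k \<noteq> j \<and> (\<forall>a\<in>N. m a = 2 * weight i j k a)"
proof -
  let ?S = "\<Sum>a\<in>N. (m a)\<^sup>2"
  let ?d = "\<lambda>i j k. \<Sum>a\<in>N. (m a - 2 * weight i j k a)\<^sup>2"
  let ?W = "\<lambda>i j k. \<Sum>a\<in>N. (weight i j k a)\<^sup>2"
  have bool: "(\<Sum>x\<in>N. f x * of_bool (a = x)) = f a" if "a \<in> N" for a and f :: "'a \<Rightarrow> real"
    using that fin by (simp add: of_bool_def if_distrib cong: if_cong)
  have mw: "m a = 2 * (\<Sum>i\<in>N. \<Sum>j\<in>N. \<Sum>k\<in>N. p i j k * weight i j k a)" if a: "a \<in> N" for a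
  proof -
    have "(\<Sum>i\<in>N. \<Sum>j\<in>N. \<Sum>k\<in>N. p i j k * weight i j k a)
        = (\<Sum>i\<in>N. \<Sum>j\<in>N. \<Sum>k\<in>N. p i j k * of_bool (a = k))
        - (\<Sum>i\<in>N. (\<Sum>j\<in>N. \<Sum>k\<in>N. p i j k) * of_bool (a = i))
        - (\<Sum>i\<in>N. \<Sum>j\<in>N. (\<Sum>k\<in>N. p i j k) * of_bool (a = j))"
      by (simp add: weight_def algebra_simps sum.distrib sum_subtractf sum_distrib_left)
    also have "\<dots> = (\<Sum>i\<in>N. \<Sum>j\<in>N. p i j a) - (\<Sum>j\<in>N. \<Sum>k\<in>N. p a j k) - (\<Sum>i\<in>N. \<Sum>k\<in>N. p i a k)"
      by (simp only: bool[OF a])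
    \<comment> \<open>By the symmetry of \<open>p\<close> both negative marginals agree, which
      accounts for the single coefficient -4 in the formula for \<open>m\<close>.\<close>
    also have "(\<Sum>j\<in>N. \<Sum>k\<in>N. p a j k) = (\<Sum>i\<in>N. \<Sum>k\<in>N. p i a k)"
      by (subst sym) simp
    finally show ?thesis by (simp add: m[OF a])
  qed
  have "?S = (\<Sum>a\<in>N. m a * (2 * (\<Sum>i\<in>N. \<Sum>j\<in>N. \<Sum>k\<in>N. p i j k * weight i j k a)))"
    by (intro sum.cong refl) (simp add: mw[symmetric] power2_eq_square)
  also have "\<dots> = (\<Sum>i\<in>N. \<Sum>j\<in>N. \<Sum>k\<in>N. 2 * p i j k * (\<Sum>a\<in>N. m a * weight i j k a))"
    unfolding sum_distrib_left
    \<comment> \<open>Each swap moves the sum over \<open>a\<close> one level inwards.\<close>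
    by (rule trans[OF sum.swap], rule sum.cong[OF refl], rule trans[OF sum.swap],
        rule sum.cong[OF refl], rule trans[OF sum.swap]) (simp add: mult_ac)
  finally have S: "?S = \<dots>" .
  have d: "?d i j k = ?S - 4 * (\<Sum>a\<in>N. m a * weight i j k a) + 4 * ?W i j k" for i j k
    by (simp add: power2_diff power_mult_distrib sum.distrib sum_subtractf sum_distrib_left mult_ac)
  \<comment> \<open>The variance of \<open>2 * weight\<close> under \<open>p\<close>: its mean is \<open>m\<close> by \<open>mw\<close>.\<close>
  have key: "?S = 12 - (\<Sum>i\<in>N. \<Sum>j\<in>N. \<Sum>k\<in>N. p i j k * (?d i j k + 4 * (3 - ?W i j k)))"
  proof -
    \<comment> \<open>Free variables \<open>S\<close>, \<open>D\<close>, \<open>W\<close>,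
      \<open>x\<close> keep the inner sums over \<open>a\<close> opaque; the terms in
      \<open>W\<close> cancel and the rest is linear in \<open>S\<close> and
      \<open>x\<close>.\<close>
    have "(\<Sum>i\<in>N. \<Sum>j\<in>N. \<Sum>k\<in>N. p i j k * (D i j k + 4 * (3 - W i j k))) = 12 - S"
      if "S = (\<Sum>i\<in>N. \<Sum>j\<in>N. \<Sum>k\<in>N. 2 * p i j k * x i j k)"
        and "\<And>i j k. D i j k = S - 4 * x i j k + 4 * W i j k" for S :: real and D W x
    proof -
      have "p i j k * (D i j k + 4 * (3 - W i j k)) = p i j k * (12 + S) - 2 * (2 * p i j k * x i j k)" for i j k
        unfolding that(2) by (simp add: algebra_simps)
      then have "(\<Sum>i\<in>N. \<Sum>j\<in>N. \<Sum>k\<in>N. p i j k * (D i j k + 4 * (3 - W i j k))) =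
          (\<Sum>i\<in>N. \<Sum>j\<in>N. \<Sum>k\<in>N. p i j k) * (12 + S) - 2 * (\<Sum>i\<in>N. \<Sum>j\<in>N. \<Sum>k\<in>N. 2 * p i j k * x i j k)"
        by (simp only: sum_subtractf sum_distrib_left[where r = 2] sum_distrib_right)
      then show ?thesis unfolding that(1)[symmetric] total by simp
    qed
    from this[OF S d] show ?thesis by linarith
  qed
  have t: "p i j k * (?d i j k + 4 * (3 - ?W i j k)) \<ge> 0" if "i \<in> N" "j \<in> N" "k \<in> N" for i j k
  \<comment> \<open>On the diagonal the squared length may be 5, making the second summand negative,
    but there \<open>p\<close> is zero.\<close>
  proof (cases "i = j")
    case False
    then show ?thesis
      using that fin by (intro mult_nonneg_nonneg add_nonneg_nonneg nn sum_nonneg) (auto simp: sum_weight_sq)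
  qed (simp add: diag)
  define T where "T i j k = p i j k * (?d i j k + 4 * (3 - ?W i j k))" for i j k
  have key': "?S = 12 - (\<Sum>i\<in>N. \<Sum>j\<in>N. \<Sum>k\<in>N. T i j k)"
    unfolding T_def by (rule key)
  have T: "T i j k \<ge> 0" if "i \<in> N" "j \<in> N" "k \<in> N" for i j k
    unfolding T_def by (rule t[OF that])
  have "0 \<le> (\<Sum>i\<in>N. \<Sum>j\<in>N. \<Sum>k\<in>N. T i j k)" by (intro sum_nonneg T)
  then show "?S \<le> 12" unfolding key' by linarith
  assume S12: "?S = 12" and ijk: "i \<in> N" "j \<in> N" "k \<in> N" and p: "p i j k \<noteq> 0"
  have "(\<Sum>i\<in>N. \<Sum>j\<in>N. \<Sum>k\<in>N. T i j k) = 0" using S12 unfolding key' by linarith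
  then have "T i j k = 0"
    using ijk T fin by (simp add: sum_nonneg_eq_0_iff sum_nonneg)
  then have 0: "p i j k * (?d i j k + 4 * (3 - ?W i j k)) = 0" by (simp only: T_def)
  have ij: "i \<noteq> j" using p diag by auto
  have "\<not> B \<and> D = 0" if "P * (D + 4 * (3 - W)) = 0" "P \<noteq> 0" "W = (if B then 1 else 3)" "D \<ge> 0"
    for P D W :: real and B
    using that by (cases B) auto
  from this[OF 0 p sum_weight_sq[OF fin ijk ij] sum_nonneg]
  have "k \<noteq> i" "k \<noteq> j" and d0: "?d i j k = 0" by auto
  moreover from d0 have "\<forall>a\<in>N. m a = 2 * weight i j k a"
    using fin by (simp add: sum_nonneg_eq_0_iff)
  ultimately show "i \<noteq> j \<and> k \<noteq> i \<and> k \<noteq> j \<and> (\<forall>a\<in>N. m a = 2 * weight i j k a)"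
    using ij by blast
qed

subsection \<open>Brackets in an orthonormal basis\<close>

lemma onb_hinner:
  fixes X :: "nat \<Rightarrow> complex^'n"
  assumes "orthonormal_basis X"
  shows "(\<Sum>k\<in>{1..CARD('n)}. hinner x (X k) * cnj (hinner y (X k))) = hinner x y"
  using onb_parseval_hinner[OF assms] by (simp add: hinner_def)

lemma onb_norm:
  fixes X :: "nat \<Rightarrow> complex^'n"
  assumes "orthonormal_basis X"
  shows "hinner x x = complex_of_real (\<Sum>k\<in>{1..CARD('n)}. (cmod (hinner x (X k)))\<^sup>2)"
  unfolding onb_hinner[OF assms, of x x, symmetric] of_real_sum complex_norm_square ..

lemma onb_eqI:
  fixes X :: "nat \<Rightarrow> complex^'n"
  assumes "orthonormal_basis X" "\<And>k. k \<in> {1..CARD('n)} \<Longrightarrow> hinner x (X k) = hinner y (X k)"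
  shows "x = y"
proof -
  have "hinner (x - y) (x - y) = 0"
    unfolding onb_hinner[OF assms(1), of "x - y" "x - y", symmetric] using assms(2)
    by (intro sum.neutral) (auto simp: hinner_simps)
  then show ?thesis by (simp add: hinner_self_eq_0_iff)
qed

lemma hinner_sum_left: "hinner (\<Sum>i\<in>I. f i) y = (\<Sum>i\<in>I. hinner (f i) y)"
  by (induction I rule: infinite_finite_induct) (auto simp: hinner_simps)

lemma onb_coordinate:
  fixes X :: "nat \<Rightarrow> complex^'n"
  assumes "orthonormal_basis X" "l \<in> {1..CARD('n)}"
  shows "hinner (\<Sum>k\<in>{1..CARD('n)}. c k *s X k) (X l) = c l"
proof -
  have "hinner (\<Sum>k\<in>{1..CARD('n)}. c k *s X k) (X l) = (\<Sum>k\<in>{1..CARD('n)}. if k = l then c k else 0)"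
    unfolding hinner_sum_left using assms
    by (intro sum.cong refl) (auto simp: hinner_simps orthonormal_basis_def)
  then show ?thesis using assms(2) by simp
qed

lemma onb_expand:
  fixes X :: "nat \<Rightarrow> complex^'n"
  assumes "orthonormal_basis X"
  shows "(\<Sum>k\<in>{1..CARD('n)}. hinner x (X k) *s X k) = x"
  by (rule onb_eqI[OF assms]) (simp only: onb_coordinate[OF assms])

text \<open>Once the sum over \<open>k\<close> is innermost, the completeness relation
  \<open>onb_complete\<close> leaves only the diagonal entries.\<close>

lemma trace_onb:
  fixes X :: "nat \<Rightarrow> complex^'n"
  assumes "orthonormal_basis X"
  shows "trace B = (\<Sum>k\<in>{1..CARD('n)}. hinner (B *v X k) (X k))"
proof -
  have "(\<Sum>k\<in>{1..CARD('n)}. hinner (B *v X k) (X k))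
      = (\<Sum>k\<in>{1..CARD('n)}. \<Sum>i\<in>UNIV. \<Sum>j\<in>UNIV. B $ i $ j * (cnj (X k $ i) * X k $ j))"
    by (simp add: hinner_def matrix_vector_mult_def sum_distrib_left sum_distrib_right mult_ac)
  also have "\<dots> = (\<Sum>i\<in>UNIV. \<Sum>j\<in>UNIV. \<Sum>k\<in>{1..CARD('n)}. B $ i $ j * (cnj (X k $ i) * X k $ j))"
    by (rule trans[OF sum.swap], rule sum.cong[OF refl], rule sum.swap)
  also have "\<dots> = (\<Sum>i\<in>UNIV. \<Sum>j\<in>UNIV. if i = j then B $ i $ j else 0)"
    by (simp only: sum_distrib_left[symmetric] onb_complete[OF assms]) (simp add: if_distrib cong: if_cong)
  also have "\<dots> = trace B" by (simp add: trace_def)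
  finally show ?thesis by simp
qed

section \<open>Alternating bilinear maps\<close>

lemma VnI:
  fixes \<mu> :: "'n::finite bracket"
  assumes "\<And>x y z. \<mu> (x + y) z = \<mu> x z + \<mu> y z" "\<And>c x y. \<mu> (c *s x) y = c *s \<mu> x y"
    "\<And>x y z. \<mu> x (y + z) = \<mu> x y + \<mu> x z" "\<And>c x y. \<mu> x (c *s y) = c *s \<mu> x y"
    "\<And>x. \<mu> x x = 0"
  shows "\<mu> \<in> Vn"
proof -
  have lin: "Vector_Spaces.linear (*s) (*s) f"
    if "\<And>x y. f (x + y) = f x + f y" "\<And>c x. f (c *s x) = c *s f x"
    for f :: "complex^'n \<Rightarrow> complex^'n"
    by (intro Vector_Spaces.linear.intro module_hom.intro module_hom_axioms.intro that
        vec.vector_space_axioms vec.module_axioms)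
  show ?thesis unfolding Vn_def using assms by (auto intro: lin)
qed

lemma Vn_simps:
  assumes "\<mu> \<in> Vn"
  shows "\<mu> (x + y) z = \<mu> x z + \<mu> y z" "\<mu> (c *s x) y = c *s \<mu> x y"
    "\<mu> x (y + z) = \<mu> x y + \<mu> x z" "\<mu> x (c *s y) = c *s \<mu> x y" "\<mu> x x = 0"
proof -
  interpret l: Vector_Spaces.linear "(*s)" "(*s)" "\<lambda>x. \<mu> x z" for z
    using assms by (simp add: Vn_def)
  interpret r: Vector_Spaces.linear "(*s)" "(*s)" "\<mu> x" for x
    using assms by (simp add: Vn_def)
  show "\<mu> (x + y) z = \<mu> x z + \<mu> y z" "\<mu> (c *s x) y = c *s \<mu> x y"
    "\<mu> x (y + z) = \<mu> x y + \<mu> x z" "\<mu> x (c *s y) = c *s \<mu> x y" "\<mu> x x = 0"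
    using assms by (simp_all add: l.add l.scale r.add r.scale Vn_def)
qed

lemma Vn_antisym: "\<mu> \<in> Vn \<Longrightarrow> \<mu> y x = - \<mu> x y"
  using Vn_simps(5)[of \<mu> "x + y"] by (simp add: Vn_simps eq_neg_iff_add_eq_0 add.commute)

lemma smul_in_Vn: "\<mu> \<in> Vn \<Longrightarrow> smul c \<mu> \<in> Vn"
  by (rule VnI) (simp_all add: smul_def Vn_simps vec.scale_right_distrib mult.commute)

lemma Vn_eqI:
  fixes X :: "nat \<Rightarrow> complex^'n"
  assumes X: "orthonormal_basis X" and V: "\<mu> \<in> Vn" "\<nu> \<in> Vn"
    and eq: "\<And>i j. i \<in> {1..CARD('n)} \<Longrightarrow> j \<in> {1..CARD('n)} \<Longrightarrow> \<mu> (X i) (X j) = \<nu> (X i) (X j)"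
  shows "\<mu> = \<nu>"
proof (intro ext)
  fix x y
  have e: "L x y = (\<Sum>j\<in>{1..CARD('n)}. hinner y (X j) *s
      (\<Sum>i\<in>{1..CARD('n)}. hinner x (X i) *s L (X i) (X j)))" if "L \<in> Vn" for L :: "'n bracket"
  proof -
    interpret l: Vector_Spaces.linear "(*s)" "(*s)" "\<lambda>x. L x z" for z
      using that by (simp add: Vn_def)
    interpret r: Vector_Spaces.linear "(*s)" "(*s)" "L z" for z
      using that by (simp add: Vn_def)
    have "L x y = L (\<Sum>i\<in>{1..CARD('n)}. hinner x (X i) *s X i) (\<Sum>j\<in>{1..CARD('n)}. hinner y (X j) *s X j)"
      by (simp only: onb_expand[OF X])
    also have "\<dots> = (\<Sum>j\<in>{1..CARD('n)}. hinner y (X j) *s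
      (\<Sum>i\<in>{1..CARD('n)}. hinner x (X i) *s L (X i) (X j)))"
      by (simp only: l.sum r.sum l.scale r.scale)
    finally show ?thesis .
  qed
  show "\<mu> x y = \<nu> x y"
    unfolding e[OF V(1)] e[OF V(2)] using eq by simp
qed

text \<open>By \<open>Mmat_basis_indep\<close> the sums defining \<open>M\<close> may run over
  \<open>X\<close>. Each summand then contributes the squared norm of an image under
  \<open>ad\<close> or its adjoint, which Parseval expands into squared moduli of structure
  constants. The result has the shape that \<open>weighted_moment_bound\<close> expects of
  \<open>m\<close>.\<close>

lemma hinner_Mmat_onb:
  fixes X :: "nat \<Rightarrow> complex^'n"
  assumes X: "orthonormal_basis X" and V: "\<mu> \<in> Vn"
  defines "p \<equiv> \<lambda>i j k. (cmod (hinner (\<mu> (X i) (X j)) (X k)))\<^sup>2"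
  shows "hinner (Mmat \<mu> *v X a) (X a) = complex_of_real
    (- 4 * (\<Sum>i\<in>{1..CARD('n)}. \<Sum>k\<in>{1..CARD('n)}. p i a k) + 2 * (\<Sum>i\<in>{1..CARD('n)}. \<Sum>j\<in>{1..CARD('n)}. p i j a))"
proof -
  let ?N = "{1..CARD('n)}"
  have ad: "ad \<mu> x *v y = \<mu> x y" for x y
    using V by (simp add: ad_def Vn_def matrix_works)
  have 1: "hinner ((adj (ad \<mu> x) ** ad \<mu> x) *v y) y = complex_of_real (\<Sum>k\<in>?N. (cmod (hinner (\<mu> x y) (X k)))\<^sup>2)" for x y
    by (simp only: matrix_vector_mul_assoc[symmetric] hinner_adj adj_adj ad onb_norm[OF X])
  have 2: "hinner ((ad \<mu> x ** adj (ad \<mu> x)) *v y) y = complex_of_real (\<Sum>k\<in>?N. (cmod (hinner (\<mu> x (X k)) y))\<^sup>2)" for x y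
  proof -
    have "cmod (hinner (adj (ad \<mu> x) *v y) (X k)) = cmod (hinner (\<mu> x (X k)) y)" for k
      by (metis ad adj_adj hinner_adj cnj_hinner complex_mod_cnj)
    then show ?thesis
      by (simp only: matrix_vector_mul_assoc[symmetric] hinner_adj[of "ad \<mu> x"] onb_norm[OF X])
  qed
  have add: "(A + B) *v x = A *v x + B *v x" for A B :: "complex^'n^'n" and x
    by (simp add: matrix_vector_mult_add_rdistrib)
  have sc: "hinner ((r *\<^sub>R A) *v x) y = complex_of_real r * hinner (A *v x) y" for r and A :: "complex^'n^'n" and x y
  proof -
    have "(r *\<^sub>R A) *v x = complex_of_real r *s (A *v x)"
      unfolding vec_eq_iff matrix_vector_mult_def vector_smult_component
      by (simp add: sum_distrib_left mult.assoc scaleR_conv_of_real[where 'a = complex])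
    then show ?thesis by (simp add: hinner_simps)
  qed
  have sum: "(\<Sum>i\<in>I. f i) *v x = (\<Sum>i\<in>I. f i *v x)" for f :: "nat \<Rightarrow> complex^'n^'n" and I x
    by (induction I rule: infinite_finite_induct) (simp_all add: add)
  show ?thesis
    unfolding Mmat_basis_indep[OF X V] add hinner_add_left sc sum hinner_sum_left 1 2 p_def
    by simp
qed

text \<open>The tensor of the 2-form \<open>a^* \<and> b^*\<close> with the vector \<open>w\<close>.
  Leaving the three vectors arbitrary makes the family stable under the action of
  \<open>GL(n)\<close>.\<close>

definition heisenberg :: "complex^'n \<Rightarrow> complex^'n \<Rightarrow> complex^'n \<Rightarrow> 'n::finite bracket" where
  "heisenberg a b w = (\<lambda>x y. (hinner x a * hinner y b - hinner x b * hinner y a) *s w)"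

definition orthonormal_triple :: "complex^'n \<Rightarrow> complex^'n \<Rightarrow> complex^'n \<Rightarrow> bool" where
  "orthonormal_triple a b w \<longleftrightarrow> hinner a a = 1 \<and> hinner b b = 1 \<and> hinner w w = 1 \<and>
    hinner a b = 0 \<and> hinner a w = 0 \<and> hinner b w = 0"

lemma orthonormal_tripleD:
  assumes "orthonormal_triple a b w"
  shows "hinner a a = 1" "hinner b b = 1" "hinner w w = 1"
    "hinner a b = 0" "hinner a w = 0" "hinner b w = 0" "hinner b a = 0" "hinner w a = 0" "hinner w b = 0"
  using assms cnj_hinner[of a b] cnj_hinner[of a w] cnj_hinner[of b w]
  by (auto simp: orthonormal_triple_def)

lemma orthonormal_basis_triple:
  fixes X :: "nat \<Rightarrow> complex^'n"
  assumes "orthonormal_basis X" "{i, j, k} \<subseteq> {1..CARD('n)}" "i \<noteq> j" "k \<noteq> i" "k \<noteq> j"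
  shows "orthonormal_triple (X i) (X j) (X k)"
  using assms by (auto simp: orthonormal_basis_def orthonormal_triple_def)

lemma heisenberg_in_Vn: "heisenberg a b w \<in> Vn"
  by (rule VnI) (simp_all add: heisenberg_def hinner_simps vec_eq_iff algebra_simps)

text \<open>In an eigenbasis of \<open>M\<close> the value of \<open>Fn\<close> is the sum of the
  squared eigenvalues, and these are the diagonal entries computed by
  \<open>hinner_Mmat_onb\<close>; norm 1 makes \<open>p\<close> a probability distribution. At the
  value 12, all nonzero structure constants share one weight, so up to antisymmetry just one
  survives.\<close>

lemma Vn_moment_bound:
  fixes \<mu> :: "'n::finite bracket"
  assumes V: "\<mu> \<in> Vn" and n1: "vnorm \<mu> = 1"
  shows "Fn (proj \<mu>) \<le> 12"
    and "Fn (proj \<mu>) = 12 \<Longrightarrow> \<exists>X c i j k. orthonormal_basis X \<and> {i, j, k} \<subseteq> {1..CARD('n)} \<and>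
      i \<noteq> j \<and> k \<noteq> i \<and> k \<noteq> j \<and> c \<noteq> 0 \<and> \<mu> = smul c (heisenberg (X i) (X j) (X k))"
proof -
  let ?N = "{1..CARD('n)}"
  have "adj (Mmat \<mu>) = Mmat \<mu>" by (simp add: adj_def vec_eq_iff Mmat_adj)
  then obtain X m where X: "orthonormal_basis X"
    and m: "\<And>i. i \<in> ?N \<Longrightarrow> Mmat \<mu> *v X i = complex_of_real (m i) *s X i"
    by (rule hermitian_eigenbasis) blast
  define p where "p i j k = (cmod (hinner (\<mu> (X i) (X j)) (X k)))\<^sup>2" for i j k
  have X1: "hinner (X i) (X i) = 1" if "i \<in> ?N" for i
    using X that by (simp add: orthonormal_basis_def)
  have mp: "m a = - 4 * (\<Sum>i\<in>?N. \<Sum>k\<in>?N. p i a k) + 2 * (\<Sum>i\<in>?N. \<Sum>j\<in>?N. p i j a)" if a: "a \<in> ?N" for a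
  proof -
    have "complex_of_real (m a) = hinner (Mmat \<mu> *v X a) (X a)"
      by (simp only: m[OF a] hinner_scale_left X1[OF a] mult_1_right)
    then show ?thesis unfolding hinner_Mmat_onb[OF X V] p_def of_real_eq_iff .
  qed
  have "trace (Mmat \<mu> ** Mmat \<mu>) = (\<Sum>a\<in>?N. hinner (Mmat \<mu> *v (Mmat \<mu> *v X a)) (X a))"
    by (simp only: trace_onb[OF X] matrix_vector_mul_assoc)
  also have "\<dots> = complex_of_real (\<Sum>a\<in>?N. (m a)\<^sup>2)"
    unfolding of_real_sum
    by (intro sum.cong refl) (simp only: m vec.scale hinner_scale_left X1 power2_eq_square of_real_mult mult_1_right)
  finally have F: "Fn (proj \<mu>) = (\<Sum>a\<in>?N. (m a)\<^sup>2)"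
    unfolding Fn_proj[OF n1, symmetric] of_real_eq_iff .
  have "complex_of_real (\<Sum>i\<in>?N. \<Sum>j\<in>?N. \<Sum>k\<in>?N. p i j k) = vinner \<mu> \<mu>"
    unfolding vinner_basis_indep[OF X V V] p_def of_real_sum complex_norm_square ..
  moreover have "Re (vinner \<mu> \<mu>) = 1" using n1 by (simp add: vnorm_def)
  ultimately have total: "(\<Sum>i\<in>?N. \<Sum>j\<in>?N. \<Sum>k\<in>?N. p i j k) = 1"
    by (metis Re_complex_of_real)
  have nn: "p i j k \<ge> 0" for i j k by (simp add: p_def)
  have sym: "p i j k = p j i k" for i j k
  proof -
    have "hinner (- x) y = - hinner x y" for x y :: "complex^'n" by (simp add: hinner_def sum_negf)
    then show ?thesis unfolding p_def by (subst Vn_antisym[OF V]) simp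
  qed
  have diag: "p i i k = 0" for i k by (simp add: p_def Vn_simps(5)[OF V] hinner_simps)
  note bound = weighted_moment_bound[OF finite_atLeastAtMost nn sym diag total mp]
  show "Fn (proj \<mu>) \<le> 12" unfolding F by (rule bound(1))
  assume "Fn (proj \<mu>) = 12"
  then have "(\<Sum>a\<in>?N. (m a)\<^sup>2) = 12" by (simp only: F)
  note rigid = bound(2)[OF _ this]
  \<comment> \<open>Total mass 1 forces some structure constant to be nonzero; its indices give the
    Heisenberg triple.\<close>
  have "\<exists>i\<in>?N. \<exists>j\<in>?N. \<exists>k\<in>?N. p i j k \<noteq> 0"
  proof (rule ccontr)
    assume "\<not> ?thesis"
    then have "(\<Sum>i\<in>?N. \<Sum>j\<in>?N. \<Sum>k\<in>?N. p i j k) = 0" by (intro sum.neutral ballI) auto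
    then show False using total by simp
  qed
  then obtain i j k where ijk: "i \<in> ?N" "j \<in> ?N" "k \<in> ?N" and p0: "p i j k \<noteq> 0" by blast
  have r: "i \<noteq> j" "k \<noteq> i" "k \<noteq> j" "\<And>a. a \<in> ?N \<Longrightarrow> m a = 2 * weight i j k a"
    using rigid[OF _ ijk p0] by auto
  define c where "c = hinner (\<mu> (X i) (X j)) (X k)"
  \<comment> \<open>Two triples in the support have the same doubled weight, namely
    \<open>m\<close>, so \<open>weight_eqD\<close> identifies them up to exchanging the
    inputs.\<close>
  have supp: "k' = k \<and> (i' = i \<and> j' = j \<or> i' = j \<and> j' = i)"
    if "i' \<in> ?N" "j' \<in> ?N" "k' \<in> ?N" "p i' j' k' \<noteq> 0" for i' j' k'
  proof -
    have q: "i' \<noteq> j'" "k' \<noteq> i'" "k' \<noteq> j'" "\<And>a. a \<in> ?N \<Longrightarrow> m a = 2 * weight i' j' k' a"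
      using rigid[OF _ that] by auto
    have "weight i j k a = weight i' j' k' a" if "a \<in> ?N" for a
      using q(4)[OF that] r(4)[OF that] by linarith
    with ijk that(1-3) r(1-3) q(1-3) show ?thesis
      by (intro weight_eqD[OF finite_atLeastAtMost[of 1 "CARD('n)"]]) simp_all
  qed
  have "\<mu> = smul c (heisenberg (X i) (X j) (X k))"
  proof (rule Vn_eqI[OF X V smul_in_Vn[OF heisenberg_in_Vn]], rule onb_eqI[OF X])
    fix i' j' k' assume N: "i' \<in> ?N" "j' \<in> ?N" "k' \<in> ?N"
    have o: "hinner (X a) (X b) = (if a = b then 1 else 0)" if "a \<in> ?N" "b \<in> ?N" for a b
      using X that by (simp add: orthonormal_basis_def)
    have R: "hinner (smul c (heisenberg (X i) (X j) (X k)) (X i') (X j')) (X k') =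
      (if k' = k \<and> i' = i \<and> j' = j then c else if k' = k \<and> i' = j \<and> j' = i then - c else 0)"
      using r(1) N ijk by (auto simp: smul_def heisenberg_def hinner_simps o)
    show "hinner (\<mu> (X i') (X j')) (X k') = hinner (smul c (heisenberg (X i) (X j) (X k)) (X i') (X j')) (X k')"
    proof (cases "p i' j' k' = 0")
      case True
      then have "\<not> (k' = k \<and> (i' = i \<and> j' = j \<or> i' = j \<and> j' = i))" using p0 sym by auto
      with True show ?thesis unfolding R by (auto simp: p_def)
    next
      case False
      have "hinner (\<mu> (X j) (X i)) (X k) = - c"
        by (subst Vn_antisym[OF V]) (simp add: c_def hinner_def sum_negf)
      then show ?thesis using supp[OF N False] r(1) unfolding R by (auto simp: c_def)
    qed
  qed
  moreover have "c \<noteq> 0" using p0 by (auto simp: c_def p_def)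
  ultimately show "\<exists>X c i j k. orthonormal_basis X \<and> {i, j, k} \<subseteq> ?N \<and>
      i \<noteq> j \<and> k \<noteq> i \<and> k \<noteq> j \<and> c \<noteq> 0 \<and> \<mu> = smul c (heisenberg (X i) (X j) (X k))"
    using X ijk r by blast
qed

lemma smul_smul: "smul c (smul d \<mu>) = smul (c * d) \<mu>"
  by (simp add: smul_def)

lemma proj_smul:
  assumes c: "c \<noteq> 0"
  shows "proj (smul c \<mu>) = proj \<mu>"
proof
  show "proj (smul c \<mu>) \<subseteq> proj \<mu>"
    using c by (auto simp: proj_def smul_smul)
  show "proj \<mu> \<subseteq> proj (smul c \<mu>)"
  proof
    fix \<nu> assume "\<nu> \<in> proj \<mu>"
    then obtain d where "d \<noteq> 0" "\<nu> = smul (d / c) (smul c \<mu>)"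
      using c by (auto simp: proj_def smul_smul)
    then show "\<nu> \<in> proj (smul c \<mu>)"
      using c unfolding proj_def by (intro CollectI exI[of _ "d / c"]) simp
  qed
qed

subsection \<open>The orbit of the Heisenberg bracket\<close>

text \<open>The output direction \<open>w\<close> is orthogonal to \<open>a\<close> and
  \<open>b\<close>, so all double brackets vanish.\<close>

lemma jacobi_heisenberg: "orthonormal_triple a b w \<Longrightarrow> jacobi (heisenberg a b w)"
  by (simp add: jacobi_def heisenberg_def hinner_simps orthonormal_tripleD)

text \<open>Contracting the 2-form with its conjugate over one slot yields the transposed projection
  onto the span of \<open>a\<close> and \<open>b\<close>; the cross terms die by
  orthogonality.\<close>

lemma heisenberg_form_contract:
  fixes a b :: "complex^'n"
  assumes "hinner a a = 1" "hinner b b = 1" "hinner a b = 0" "hinner b a = 0"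
  shows "(\<Sum>j\<in>UNIV. (cnj (a $ i) * cnj (b $ j) - cnj (b $ i) * cnj (a $ j)) *
      cnj (cnj (a $ l) * cnj (b $ j) - cnj (b $ l) * cnj (a $ j)))
    = cnj (a $ i) * a $ l + cnj (b $ i) * b $ l"
proof -
  have "(\<Sum>j\<in>UNIV. (cnj (a $ i) * cnj (b $ j) - cnj (b $ i) * cnj (a $ j)) *
      cnj (cnj (a $ l) * cnj (b $ j) - cnj (b $ l) * cnj (a $ j)))
    = cnj (a $ i) * a $ l * hinner b b - cnj (a $ i) * b $ l * hinner a b
      - cnj (b $ i) * a $ l * hinner b a + cnj (b $ i) * b $ l * hinner a a"
    unfolding hinner_def sum_distrib_left sum_subtractf[symmetric] sum.distrib[symmetric]
    by (intro sum.cong refl) (simp add: algebra_simps)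
  then show ?thesis using assms by simp
qed

text \<open>This is \<open>4 * (P_w - P_a - P_b)\<close> with \<open>P\<close> the orthogonal
  projections onto lines. The first sum in \<open>Mmat\<close> contracts one input and the output,
  giving \<open>P_a + P_b\<close>; the second contracts both inputs, giving
  \<open>2 * P_w\<close>.\<close>

lemma Mmat_heisenberg:
  fixes a b w :: "complex^'n"
  assumes "orthonormal_triple a b w"
  shows "Mmat (heisenberg a b w) $ i $ j =
    4 * (w $ i * cnj (w $ j) - a $ i * cnj (a $ j) - b $ i * cnj (b $ j))"
proof -
  note o = orthonormal_tripleD[OF assms]
  define f where "f i j = cnj (a $ i) * cnj (b $ j) - cnj (b $ i) * cnj (a $ j)" for i j
  have h: "heisenberg a b w (axis i 1) (axis j 1) $ k = f i j * w $ k" for i j k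
  proof -
    have "hinner (axis i 1) z = cnj (z $ i)" for i and z :: "complex^'n"
      by (metis cnj_hinner hinner_axis)
    then show ?thesis by (simp add: heisenberg_def f_def algebra_simps)
  qed
  have f: "(\<Sum>j\<in>UNIV. f i j * cnj (f l j)) = cnj (a $ i) * a $ l + cnj (b $ i) * b $ l" for i l
    unfolding f_def by (rule heisenberg_form_contract) (simp_all add: o)
  have anti: "f j i = - f i j" for i j by (simp add: f_def)
  have w: "(\<Sum>l\<in>UNIV. w $ l * cnj (w $ l)) = 1" using o(3) by (simp add: hinner_def)
  have "(\<Sum>r\<in>UNIV. \<Sum>l\<in>UNIV. f r j * w $ l * cnj (f r i * w $ l)) = (\<Sum>r\<in>UNIV. f j r * cnj (f i r))"
  proof (intro sum.cong refl)
    fix r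
    have "(\<Sum>l\<in>UNIV. f r j * w $ l * cnj (f r i * w $ l)) = f r j * cnj (f r i) * (\<Sum>l\<in>UNIV. w $ l * cnj (w $ l))"
      by (simp add: sum_distrib_left mult_ac)
    also have "\<dots> = f j r * cnj (f i r)" by (simp add: w anti[of r])
    finally show "(\<Sum>l\<in>UNIV. f r j * w $ l * cnj (f r i * w $ l)) = f j r * cnj (f i r)" .
  qed
  then have A: "(\<Sum>r\<in>UNIV. \<Sum>l\<in>UNIV. f r j * w $ l * cnj (f r i * w $ l)) = cnj (a $ j) * a $ i + cnj (b $ j) * b $ i"
    by (simp only: f)
  have "(\<Sum>r\<in>UNIV. \<Sum>l\<in>UNIV. f r l * w $ i * cnj (f r l * w $ j))
      = w $ i * cnj (w $ j) * (\<Sum>r\<in>UNIV. \<Sum>l\<in>UNIV. f r l * cnj (f r l))"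
    by (simp add: sum_distrib_left mult_ac)
  also have "\<dots> = w $ i * cnj (w $ j) * (\<Sum>r\<in>UNIV. a $ r * cnj (a $ r) + b $ r * cnj (b $ r))"
    by (simp only: f mult.commute)
  also have "\<dots> = 2 * (w $ i * cnj (w $ j))"
    using o(1,2) by (simp add: sum.distrib hinner_def)
  finally have B: "(\<Sum>r\<in>UNIV. \<Sum>l\<in>UNIV. f r l * w $ i * cnj (f r l * w $ j)) = 2 * (w $ i * cnj (w $ j))" .
  show ?thesis
    unfolding Mmat_def vector_add_component vector_scaleR_component sum_component
      adj_ad_mult_nth ad_adj_mult_nth h A B
    by (simp add: scaleR_conv_of_real[where 'a = complex] algebra_simps)
qed

text \<open>For every bracket the trace of \<open>M\<close> is \<open>(- 4 + 2)\<close> times the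
  squared norm. Here \<open>Mmat_heisenberg\<close> gives trace
  \<open>4 * (1 - 1 - 1)\<close>.\<close>

lemma vinner_heisenberg:
  fixes a b w :: "complex^'n"
  assumes "orthonormal_triple a b w"
  shows "vinner (heisenberg a b w) (heisenberg a b w) = 2"
proof -
  let ?h = "heisenberg a b w"
  note o = orthonormal_tripleD[OF assms]
  have tr: "(\<Sum>i\<in>UNIV. Mmat ?h $ i $ i) = - 4"
    using o(1-3) unfolding Mmat_heisenberg[OF assms] hinner_def
    by (simp add: sum_distrib_left[symmetric] sum_subtractf)
  have v: "(\<Sum>j\<in>UNIV. \<Sum>r\<in>UNIV. \<Sum>l\<in>UNIV. ?h (axis r 1) (axis j 1) $ l * cnj (?h (axis r 1) (axis j 1) $ l)) = vinner ?h ?h"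
    unfolding vinner_coord by (rule sum.swap)
  have "(\<Sum>j\<in>UNIV. \<Sum>r\<in>UNIV. \<Sum>l\<in>UNIV. ?h (axis r 1) (axis l 1) $ j * cnj (?h (axis r 1) (axis l 1) $ j))
      = (\<Sum>r\<in>UNIV. \<Sum>j\<in>UNIV. \<Sum>l\<in>UNIV. ?h (axis r 1) (axis l 1) $ j * cnj (?h (axis r 1) (axis l 1) $ j))"
    by (rule sum.swap)
  also have "\<dots> = vinner ?h ?h"
    unfolding vinner_coord by (intro sum.cong refl sum.swap)
  finally have v': "(\<Sum>j\<in>UNIV. \<Sum>r\<in>UNIV. \<Sum>l\<in>UNIV. ?h (axis r 1) (axis l 1) $ j * cnj (?h (axis r 1) (axis l 1) $ j)) = vinner ?h ?h" .
  have "(\<Sum>i\<in>UNIV. Mmat ?h $ i $ i) = - 4 * vinner ?h ?h + 2 * vinner ?h ?h"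
    unfolding Mmat_def vector_add_component vector_scaleR_component sum_component
      adj_ad_mult_nth ad_adj_mult_nth sum.distrib scaleR_sum_right[symmetric] v v'
    by (simp add: scaleR_conv_of_real[where 'a = complex])
  then show ?thesis using tr by (simp add: algebra_simps)
qed

text \<open>The eigenvalues 4, -4, -4 square to 16 on the span of \<open>w\<close>,
  \<open>a\<close>, \<open>b\<close>, and \<open>M\<close> is zero on the orthogonal complement, so
  the trace is \<open>3 * 16\<close>.\<close>

lemma trace_Mmat_heisenberg:
  fixes a b w :: "complex^'n"
  assumes "orthonormal_triple a b w"
  shows "trace (Mmat (heisenberg a b w) ** Mmat (heisenberg a b w)) = 48"
proof -
  note o = orthonormal_tripleD[OF assms]
  let ?M = "Mmat (heisenberg a b w)"
  have M: "?M *v x = 4 *s (hinner x w *s w - hinner x a *s a - hinner x b *s b)" for x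
    unfolding vec_eq_iff
    by (simp add: matrix_vector_mult_def Mmat_heisenberg[OF assms] hinner_def sum_distrib_left
        sum_distrib_right sum_subtractf sum.distrib algebra_simps)
  have MM: "?M *v (?M *v x) = 16 *s (hinner x w *s w + hinner x a *s a + hinner x b *s b)" for x
    by (simp add: M hinner_simps o vec_eq_iff algebra_simps)
  have t: "trace B = (\<Sum>i\<in>UNIV. (B *v axis i 1) $ i)" for B :: "complex^'n^'n"
    unfolding trace_def matrix_vector_mult_def axis_def by (simp add: if_distrib cong: if_cong)
  have ax: "hinner (axis i 1) z = cnj (z $ i)" for i and z :: "complex^'n"
    by (metis cnj_hinner hinner_axis)
  have "trace (?M ** ?M) = (\<Sum>i\<in>UNIV. 16 * (w $ i * cnj (w $ i) + a $ i * cnj (a $ i) + b $ i * cnj (b $ i)))"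
    unfolding t matrix_vector_mul_assoc[symmetric] MM ax by (simp add: algebra_simps)
  also have "\<dots> = 48"
    using o(1-3) by (simp add: sum_distrib_left[symmetric] sum.distrib hinner_def)
  finally show ?thesis .
qed

lemma Fn_heisenberg:
  fixes a b w :: "complex^'n"
  assumes "orthonormal_triple a b w"
  shows "Fn (proj (heisenberg a b w)) = 12"
proof -
  \<comment> \<open>The squared norm of the bracket is 2. Scaling by \<open>c\<close> halves
    \<open>M\<close> and so quarters the trace of its square: \<open>48 / 4 = 12\<close>.\<close>
  define c where "c = complex_of_real (1 / sqrt 2)"
  let ?h = "heisenberg a b w"
  have c: "c \<noteq> 0" "cmod c = 1 / sqrt 2" by (simp_all add: c_def norm_divide)
  have "vnorm (smul c ?h) = 1"
    by (simp add: vnorm_smul c(2)) (simp add: vnorm_def vinner_heisenberg[OF assms])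
  then have "complex_of_real (Fn (proj ?h)) = trace (Mmat (smul c ?h) ** Mmat (smul c ?h))"
    using Fn_proj[of "smul c ?h"] by (simp add: proj_smul c(1))
  also have "\<dots> = complex_of_real (1 / 4) * trace (Mmat ?h ** Mmat ?h)"
    by (simp add: Mmat_smul c(2) power_divide trace_def matrix_matrix_mult_def sum_distrib_left
        scaleR_conv_of_real[where 'a = complex])
  also have "\<dots> = complex_of_real 12"
    by (simp add: trace_Mmat_heisenberg[OF assms])
  finally show ?thesis unfolding of_real_eq_iff .
qed

section \<open>The action of GL(n) on Heisenberg brackets\<close>

lemma act_heisenberg:
  "act g (heisenberg a b w) = heisenberg (adj (matrix_inv g) *v a) (adj (matrix_inv g) *v b) (g *v w)"
  by (simp only: act_def heisenberg_def hinner_adj vec.scale)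

lemma smul_heisenberg:
  "heisenberg (r *s a) (s *s b) (t *s w) = smul (cnj r * cnj s * t) (heisenberg a b w)"
  by (simp add: heisenberg_def smul_def hinner_simps fun_eq_iff vec_eq_iff algebra_simps)

text \<open>The added multiple of \<open>a\<close> wedges to zero with \<open>a\<close>; hence the
  Gram-Schmidt correction of \<open>b\<close> leaves the bracket alone.\<close>

lemma heisenberg_shear: "heisenberg a (b - t *s a) w = heisenberg a b w"
  by (simp add: heisenberg_def hinner_simps algebra_simps)

text \<open>Gram-Schmidt on \<open>a\<close>, \<open>b\<close> preserves the bracket, and
  normalising the three vectors costs only a scalar. Orthogonality to \<open>w\<close> passes to the
  corrected vector, which is a combination of \<open>a\<close> and \<open>b\<close>.\<close>

lemma heisenberg_orthonormalise:
  fixes a b w :: "complex^'n"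
  assumes ind: "\<And>s t. s *s a + t *s b = 0 \<Longrightarrow> s = 0 \<and> t = 0"
    and w: "w \<noteq> 0" "hinner a w = 0" "hinner b w = 0"
  obtains a' b' w' c where "orthonormal_triple a' b' w'" "c \<noteq> 0"
    "heisenberg a b w = smul c (heisenberg a' b' w')"
proof -
  define t where "t = hinner b a / hinner a a"
  define d where "d = b - t *s a"
  have a: "a \<noteq> 0" using ind[of 1 0] by auto
  have d0: "d \<noteq> 0" using ind[of "- t" 1] by (auto simp: d_def)
  have da: "hinner d a = 0"
    using a by (simp add: d_def t_def hinner_simps hinner_self_eq_0_iff)
  then have ad: "hinner a d = 0" using cnj_hinner[of d a] by simp
  have dw: "hinner d w = 0" by (simp add: d_def hinner_simps w)
  define u where "u x = complex_of_real (1 / norm x) *s x" for x :: "complex^'n"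
  have u1: "hinner (u x) (u x) = 1" if "x \<noteq> 0" for x
    using that unfolding u_def hinner_scale_left hinner_scale_right hinner_self[of x]
    by (simp add: power2_eq_square)
  have u: "complex_of_real (norm x) *s u x = x" for x
    by (simp add: u_def)
  have "orthonormal_triple (u a) (u d) (u w)"
    unfolding orthonormal_triple_def
    using a d0 w(1) by (simp add: u1) (simp add: u_def hinner_simps ad w dw)
  moreover have "heisenberg a b w = heisenberg a d w"
    by (simp only: d_def heisenberg_shear)
  then have "heisenberg a b w = smul (norm a * norm d * norm w) (heisenberg (u a) (u d) (u w))"
    using smul_heisenberg[of "norm a" "u a" "norm d" "u d" "norm w" "u w"] by (simp add: u)
  ultimately show thesis
    using a d0 w(1) by (intro that[of "u a" "u d" "u w" "norm a * norm d * norm w"]) simp_all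
qed

lemma matrix_inv_cancel:
  assumes "invertible A"
  shows "A ** matrix_inv A = mat 1" "matrix_inv A ** A = mat 1"
proof -
  have "\<exists>B. A ** B = mat 1 \<and> B ** A = mat 1" using assms by (simp add: invertible_def)
  then have "A ** matrix_inv A = mat 1 \<and> matrix_inv A ** A = mat 1"
    unfolding matrix_inv_def by (rule someI_ex)
  then show "A ** matrix_inv A = mat 1" "matrix_inv A ** A = mat 1" by auto
qed

text \<open>The functionals move by \<open>adj (matrix_inv g)\<close> and the vector by
  \<open>g\<close>, so their pairings are unchanged. This preserves independence and the
  orthogonality to \<open>w\<close>, as \<open>heisenberg_orthonormalise\<close> requires.\<close>

lemma act_heisenberg_orthonormalise:
  fixes g :: "complex^'n^'n"
  assumes g: "invertible g" and o: "orthonormal_triple a b w"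
  obtains a' b' w' c where "orthonormal_triple a' b' w'" "c \<noteq> 0"
    "act g (heisenberg a b w) = smul c (heisenberg a' b' w')"
proof -
  let ?h = "matrix_inv g"
  have inv: "g ** ?h = mat 1" "?h ** g = mat 1"
    using matrix_inv_cancel[OF g] by auto
  have hg: "?h *v (g *v x) = x" for x
    by (simp add: matrix_vector_mul_assoc inv)
  have move: "hinner (adj ?h *v x) (g *v y) = hinner x y" for x y
    by (simp add: hinner_adj hg)
  have ind: "s = 0 \<and> t = 0" if "s *s (adj ?h *v a) + t *s (adj ?h *v b) = 0" for s t
  proof -
    \<comment> \<open>Pairing the relation with \<open>g *v a\<close> and \<open>g *v b\<close>
      reads off \<open>s\<close> and \<open>t\<close>.\<close>
    have "0 = hinner (s *s (adj ?h *v a) + t *s (adj ?h *v b)) (g *v a)"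
      "0 = hinner (s *s (adj ?h *v a) + t *s (adj ?h *v b)) (g *v b)"
      unfolding that by (simp_all add: hinner_simps)
    then show ?thesis
      by (simp add: hinner_simps move orthonormal_tripleD[OF o])
  qed
  have perp: "hinner (adj ?h *v a) (g *v w) = 0" "hinner (adj ?h *v b) (g *v w) = 0"
    by (simp_all only: move orthonormal_tripleD[OF o])
  have gw: "g *v w \<noteq> 0"
    using hg[of w] orthonormal_tripleD(3)[OF o] by (metis hinner_zero_left zero_neq_one matrix_vector_mult_0_right)
  obtain a' b' w' c where "orthonormal_triple a' b' w'" "c \<noteq> 0"
    "heisenberg (adj ?h *v a) (adj ?h *v b) (g *v w) = smul c (heisenberg a' b' w')"
    by (rule heisenberg_orthonormalise[OF ind gw perp])
  then show thesis unfolding act_heisenberg[symmetric] by (rule that)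
qed

text \<open>Serves to renumber an orthonormal basis so that a prescribed triple occupies the
  positions 1, 2, 3.\<close>

lemma bij_betw_extend_triple:
  assumes "finite N" "{i, j, k} \<subseteq> N" "{i', j', k'} \<subseteq> N"
    "i \<noteq> j" "k \<noteq> i" "k \<noteq> j" "i' \<noteq> j'" "k' \<noteq> i'" "k' \<noteq> j'"
  obtains f where "bij_betw f N N" "f i = i'" "f j = j'" "f k = k'"
proof -
  have "card (N - {i, j, k}) = card (N - {i', j', k'})"
    using assms by (simp add: card_Diff_subset)
  then obtain g where g: "bij_betw g (N - {i, j, k}) (N - {i', j', k'})"
    using assms(1) by (metis finite_Diff finite_same_card_bij)
  define f where "f = g(i := i', j := j', k := k')"
  have "bij_betw f {i, j, k} {i', j', k'}"
    using assms(4-9) by (auto simp: f_def bij_betw_def inj_on_def)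
  moreover have "bij_betw f (N - {i, j, k}) (N - {i', j', k'})"
    using g by (rule bij_betw_cong[THEN iffD1, rotated]) (auto simp: f_def)
  ultimately have "bij_betw f ({i, j, k} \<union> (N - {i, j, k})) ({i', j', k'} \<union> (N - {i', j', k'}))"
    by (rule bij_betw_combine) auto
  moreover have "{i, j, k} \<union> (N - {i, j, k}) = N" "{i', j', k'} \<union> (N - {i', j', k'}) = N"
    using assms(2,3) by auto
  ultimately have "bij_betw f N N" by simp
  then show thesis using that[of f] assms(4-6) by (simp add: f_def)
qed

text \<open>The matrix is the sum of the rank-one maps \<open>Y_k X_k^*\<close>; exchanging the
  bases gives both its adjoint and its inverse. Unitarity is stated as
  \<open>adj (matrix_inv g) = g\<close>, so that in \<open>act_heisenberg\<close> all three vectors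
  move by \<open>g\<close>.\<close>

lemma unitary_between_bases:
  fixes X Y :: "nat \<Rightarrow> complex^'n"
  assumes X: "orthonormal_basis X" and Y: "orthonormal_basis Y"
  obtains g where "invertible g" "adj (matrix_inv g) = g"
    "\<And>l. l \<in> {1..CARD('n)} \<Longrightarrow> g *v X l = Y l"
proof -
  define U :: "(nat \<Rightarrow> complex^'n) \<Rightarrow> (nat \<Rightarrow> complex^'n) \<Rightarrow> complex^'n^'n"
    where "U A B = (\<chi> r c. \<Sum>k\<in>{1..CARD('n)}. B k $ r * cnj (A k $ c))" for A B
  have U: "U A B *v x = (\<Sum>k\<in>{1..CARD('n)}. hinner x (A k) *s B k)" for A B x
  proof -
    have "(U A B *v x) $ r = (\<Sum>k\<in>{1..CARD('n)}. hinner x (A k) *s B k) $ r" for r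
    proof -
      have "(U A B *v x) $ r = (\<Sum>c\<in>UNIV. \<Sum>k\<in>{1..CARD('n)}. x $ c * cnj (A k $ c) * B k $ r)"
        by (simp add: U_def matrix_vector_mult_def sum_distrib_left sum_distrib_right mult_ac)
      also have "\<dots> = (\<Sum>k\<in>{1..CARD('n)}. \<Sum>c\<in>UNIV. x $ c * cnj (A k $ c) * B k $ r)"
        by (rule sum.swap)
      finally show ?thesis by (simp add: hinner_def sum_distrib_right)
    qed
    then show ?thesis by (simp add: vec_eq_iff)
  qed
  have adj: "adj (U A B) = U B A" for A B
    by (simp add: adj_def U_def vec_eq_iff mult.commute)
  have inv: "U B A ** U A B = mat 1" if "orthonormal_basis A" "orthonormal_basis B" for A B
    unfolding matrix_eq matrix_vector_mul_assoc[symmetric]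
  proof
    fix x
    show "U B A *v (U A B *v x) = mat 1 *v x"
      unfolding U[of B A] U[of A B] using onb_coordinate[OF that(2)] onb_expand[OF that(1), of x]
      by simp
  qed
  let ?g = "U X Y"
  have 1: "?g ** U Y X = mat 1" "U Y X ** ?g = mat 1" using inv X Y by auto
  then have g: "invertible ?g" unfolding invertible_def by blast
  have "matrix_inv ?g = U Y X"
  proof -
    have "matrix_inv ?g = matrix_inv ?g ** (?g ** U Y X)" by (simp add: 1)
    also have "\<dots> = U Y X" by (simp add: matrix_mul_assoc matrix_inv_cancel[OF g])
    finally show ?thesis .
  qed
  then have "adj (matrix_inv ?g) = ?g" by (simp add: adj)
  moreover have "?g *v X l = Y l" if l: "l \<in> {1..CARD('n)}" for l
  proof (rule onb_eqI[OF Y])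
    fix k assume k: "k \<in> {1..CARD('n)}"
    then show "hinner (?g *v X l) (Y k) = hinner (Y l) (Y k)"
      unfolding U onb_coordinate[OF Y k] using X Y l by (simp add: orthonormal_basis_def)
  qed
  ultimately show thesis using that g by blast
qed

section \<open>The maximum of the functional on Lie brackets\<close>

theorem theorem4p6:
  fixes X :: "nat \<Rightarrow> complex^'n" and mu_he :: "'n bracket"
  assumes "CARD('n) \<ge> 3"
    and "orthonormal_basis X"
    and "mu_he \<in> Vn"
    and "mu_he (X 1) (X 2) = X 3"
    and "\<forall>i\<in>{1..CARD('n)}. \<forall>j\<in>{1..CARD('n)}. i < j \<and> (i, j) \<noteq> (1, 2) \<longrightarrow> mu_he (X i) (X j) = 0"
  shows "(\<forall>p\<in>(Lie_n :: 'n bracket set set). (\<forall>q\<in>(Lie_n :: 'n bracket set set). Fn q \<le> Fn p) \<longleftrightarrow> p \<in> GL_orbit (proj mu_he)) \<and> Fn (proj mu_he) = 12"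
proof -
  let ?N = "{1..CARD('n)}"
  note X = assms(2)
  have N: "1 \<in> ?N" "2 \<in> ?N" "3 \<in> ?N" using assms(1) by auto
  have o: "hinner (X i) (X j) = (if i = j then 1 else 0)" if "i \<in> ?N" "j \<in> ?N" for i j
    using X that by (simp add: orthonormal_basis_def)
  \<comment> \<open>The hypotheses fix the values on pairs with \<open>i < j\<close>; antisymmetry
    supplies the others.\<close>
  have he: "mu_he = heisenberg (X 1) (X 2) (X 3)"
  proof (rule Vn_eqI[OF X assms(3) heisenberg_in_Vn])
    have lt: "mu_he (X i) (X j) = heisenberg (X 1) (X 2) (X 3) (X i) (X j)"
      if "i \<in> ?N" "j \<in> ?N" "i < j" for i j
    proof (cases "(i, j) = (1, 2)")
      case True
      then show ?thesis using assms(4) N by (simp add: heisenberg_def o del: atLeastAtMost_iff)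
    next
      case False
      then show ?thesis using assms(5) that N
        by (auto simp: heisenberg_def o simp del: atLeastAtMost_iff)
    qed
    fix i j assume ij: "i \<in> ?N" "j \<in> ?N"
    consider "i < j" | "i = j" | "j < i" by linarith
    then show "mu_he (X i) (X j) = heisenberg (X 1) (X 2) (X 3) (X i) (X j)"
    proof cases
      case 3
      then show ?thesis
        using lt[OF ij(2,1)] Vn_antisym[OF assms(3), of "X i" "X j"]
          Vn_antisym[OF heisenberg_in_Vn, of "X 1" "X 2" "X 3" "X i" "X j"] by simp
    qed (use lt ij in \<open>auto simp: Vn_simps(5) assms(3) heisenberg_in_Vn\<close>)
  qed
  have triple: "orthonormal_triple (X 1) (X 2) (X 3)"
    by (rule orthonormal_basis_triple[OF X]) (use N in auto)
  have F: "Fn (proj mu_he) = 12" unfolding he by (rule Fn_heisenberg[OF triple])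
  have unit: "\<exists>\<nu>\<in>Vn. vnorm \<nu> = 1 \<and> p = proj \<nu>" if "p \<in> Lie_n" for p :: "'n bracket set"
  proof -
    from that obtain \<mu> where \<mu>: "p = proj \<mu>" "\<mu> \<in> Vn" "\<mu> \<noteq> (\<lambda>x y. 0)"
      by (auto simp: Lie_n_def)
    from Vn_normalize[OF \<mu>(2,3)] obtain c where "c \<noteq> 0" "vnorm (smul c \<mu>) = 1"
      by (auto simp: proj_def)
    then show ?thesis using \<mu> by (intro bexI[of _ "smul c \<mu>"]) (simp_all add: proj_smul smul_in_Vn)
  qed
  have "mu_he (X 1) (X 2) \<noteq> 0" using assms(4) o[OF N(3,3)] by (auto simp: hinner_simps)
  then have "proj mu_he \<in> Lie_n"
    unfolding Lie_n_def using assms(3) jacobi_heisenberg[OF triple] he by fastforce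
  have "(\<forall>q\<in>(Lie_n :: 'n bracket set set). Fn q \<le> Fn p) \<longleftrightarrow> p \<in> GL_orbit (proj mu_he)"
    if p: "p \<in> Lie_n" for p :: "'n bracket set"
  proof
    assume max: "\<forall>q\<in>(Lie_n :: 'n bracket set set). Fn q \<le> Fn p"
    obtain \<nu> where \<nu>: "\<nu> \<in> Vn" "vnorm \<nu> = 1" "p = proj \<nu>" using unit[OF p] by blast
    \<comment> \<open>The general bound gives at most 12, and maximality against
      \<open>mu_he\<close> gives at least 12.\<close>
    have "Fn (proj \<nu>) = 12"
      using Vn_moment_bound(1)[OF \<nu>(1,2)] max \<open>proj mu_he \<in> Lie_n\<close> F \<nu>(3) by fastforce
    from Vn_moment_bound(2)[OF \<nu>(1,2) this] obtain Y c i j k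
      where Y: "orthonormal_basis Y" "{i, j, k} \<subseteq> ?N" "i \<noteq> j" "k \<noteq> i" "k \<noteq> j"
        and c: "c \<noteq> 0" "\<nu> = smul c (heisenberg (Y i) (Y j) (Y k))"
      by blast
    obtain f where f: "bij_betw f ?N ?N" "f 1 = i" "f 2 = j" "f 3 = k"
      by (rule bij_betw_extend_triple[of ?N 1 2 3 i j k]) (use Y N in auto)
    have "orthonormal_basis (Y \<circ> f)"
    proof -
      have "f a \<in> ?N" if "a \<in> ?N" for a using f(1) that by (auto simp: bij_betw_def)
      moreover have "f a = f b \<longleftrightarrow> a = b" if "a \<in> ?N" "b \<in> ?N" for a b
        using f(1) that by (meson bij_betw_def inj_on_eq_iff)
      ultimately show ?thesis using Y(1) unfolding orthonormal_basis_def comp_def by metis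
    qed
    \<comment> \<open>The reordered basis starts with \<open>Y i\<close>, \<open>Y j\<close>,
      \<open>Y k\<close>, so this unitary carries \<open>mu_he\<close> to the Heisenberg bracket
      found above.\<close>
    from unitary_between_bases[OF X this] obtain g where g: "invertible g" "adj (matrix_inv g) = g"
      "\<And>l. l \<in> ?N \<Longrightarrow> g *v X l = (Y \<circ> f) l" by blast
    have "act g mu_he = heisenberg (Y i) (Y j) (Y k)"
      using f by (simp only: he act_heisenberg g(2) g(3)[OF N(1)] g(3)[OF N(2)] g(3)[OF N(3)] comp_apply)
    then have "p = pact g (proj mu_he)"
      by (simp add: \<nu>(3) c pact_proj proj_smul)
    then show "p \<in> GL_orbit (proj mu_he)" using g(1) by (auto simp: GL_orbit_def)
  next
    assume "p \<in> GL_orbit (proj mu_he)"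
    then obtain g where g: "invertible g" "p = proj (act g mu_he)"
      by (auto simp: GL_orbit_def pact_proj)
    \<comment> \<open>Each point of the orbit is the class of an orthonormal Heisenberg bracket, so
      it has the value 12, the upper bound.\<close>
    obtain a b w c where "orthonormal_triple a b w" "c \<noteq> 0" "act g mu_he = smul c (heisenberg a b w)"
      unfolding he by (rule act_heisenberg_orthonormalise[OF g(1) triple])
    then have "Fn p = 12" by (simp add: g(2) proj_smul Fn_heisenberg)
    moreover have "Fn q \<le> 12" if "q \<in> Lie_n" for q :: "'n bracket set"
      using unit[OF that] Vn_moment_bound(1) by blast
    ultimately show "\<forall>q\<in>(Lie_n :: 'n bracket set set). Fn q \<le> Fn p" by simp
  qed
  with F show ?thesis by blast
qed

end
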